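(* Consider a dynamic generalized factor analysis (DGFA) model and its truncations $$\mathbf x(t+1)=A\mathbf x(t)+\mathbf v(t),\qquad \mathbf y_N(t)=C_N\mathbf x(t)+\mathbf w_N(t),\qquad N=1,2,\dots$$ satisfying all the standing assumptions (A)–(F) listed in the context. Let $\hat{\mathbf x}_N(t)$ be the steady-state (pure) Kalman filter estimate of $\mathbf x(t)$ and consider the steady-state covariance matrix of the state filtering error $$\Pi_N:=\mathbb E\big[(\mathbf x(t)-\hat{\mathbf x}_N(t))(\mathbf x(t)-\hat{\mathbf x}_N(t))^\top\big]=\big[P_N^{-1}+C_N^\top R_N^{-1}C_N\big]^{-1}.$$ Then $\Pi_N$ converges to the zero matrix as $N\to\infty$.
   Context: All random variables are real, zero-mean, with finite variance; $^\top$ is transpose, $\|\cdot\|$ on matrices is the operator (spectral) norm. Model. Time is $t\in\mathbb Z$. The infinite-dimensional model is $\mathbf x(t+1)=A\mathbf x(t)+\mathbf v(t)$, $\mathbf y(t)=C\mathbf x(t)+\mathbf w(t)$, where $\mathbf x(t)$ and $\mathbf v(t)$ are $n$-dimensional ($n\ge 1$ fixed), $\mathbf y(t),\mathbf w(t)$ are random vectors with countably many components, and $C$ is an $\infty\times n$ real matrix. $\mathbf y_N(t)$, $\mathbf w_N(t)$ denote the vectors of the first $N$ components of $\mathbf y(t)$, $\mathbf w(t)$, and $C_N\in\mathbb R^{N\times n}$ consists of the first $N$ rows of $C$. Standing assumptions: (A) $A\in\mathbb R^{n\times n}$ is asymptotically stable (all eigenvalues of modulus $<1$), $\mathbf v$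 is a white noise with covariance $Q$, and $\mathbf x$ is the stationary process solving the state equation. (B) $\mathbf w$ is a stationary white noise (in $t$), uncorrelated with $\mathbf v$ at all times; its components need not be mutually uncorrelated. (C) The columns of $C$ are strongly linearly independent, i.e. $\lim_{N\to\infty}\lambda_{\min}[C_N^\top C_N]=+\infty$, with $\lambda_{\min}$ the smallest eigenvalue. (D) $\mathbf w(0)$ (hence $\mathbf w(t)$ for every $t$) is an idiosyncratic sequence with respect to the cross-sectional index; equivalently, with $R_N:=\mathbb E[\mathbf w_N(t)\mathbf w_N(t)^\top]$, $\sup_N\|R_N\|<\infty$. (E) The model is wide-sense stationary and minimal, so that $(A,Q)$ is reachable. (F) $R_N>0$ (positive definite) for all $N$. Idiosyncratic. A zero-mean random sequence $\mathbf z=(\mathbf z(k))_{k\ge1}$ with covariance $\Sigma$ is idiosyncratic if $\lim_{m\to\infty}a_m^\top\mathbf z=0$ in mean square for every sequence $(a_m)$ of elements of $\ell^2$ with $a_m^\top\Sigma a_m<\infty$ and $\|a_m\|_{\ell^2}\to0$; equivalently, the covariances of the truncations to the first $N$ components are bounded in operator norm uniformly in $N$. Kalman quantities. $\hat{\mathbf x}_N(t)$ is the best linear (minimum-variance) estimate of $\mathbf x(t)$ given $\{\mathbf y_N(s):s\le t\}$ (infinite past up to and including time $t$), and $\hat{\mathbf x}_N(t\mid t-1)$ the one given $\{\mathbf y_N(s):s\le t-1\}$. $P_N$, the covariance of $\mathbf x(t)-\hat{\mathbf x}_N(t\mid t-1)$, is the (positive definite) stabilizing solution of $$P_N=A\big[P_N-P_NC_N^\top(C_NP_NC_N^\top+R_N)^{-1}C_NP_N\big]A^\top+Q.$$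 *)

theory Defs
  imports "HOL-Probability.Probability" "Jordan_Normal_Form.Spectral_Radius"
begin

unbundle no vec_syntax
hide_type (open) Finite_Cartesian_Product.vec
hide_const (open) Finite_Cartesian_Product.vec Finite_Cartesian_Product.transpose
  Finite_Cartesian_Product.mat Inner_Product.real_inner_class.inner
no_notation Inner_Product.real_inner_class.inner (infix "\<bullet>" 70)

section \<open>Matrices\<close>

definition positive_definite :: "nat \<Rightarrow> real mat \<Rightarrow> bool" where
  "positive_definite n S \<longleftrightarrow> S \<in> carrier_mat n n \<and> S\<^sup>T = S \<and>
     (\<forall>u \<in> carrier_vec n. u \<noteq> 0\<^sub>v n \<longrightarrow> u \<bullet> (S *\<^sub>v u) > 0)"

text \<open>Meaningful for symmetric matrices of positive size, whose complex eigenvalues are all real.\<close>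
definition lambda_min :: "real mat \<Rightarrow> real" where
  "lambda_min S = Min (spectrum S)"

definition asymptotically_stable :: "real mat \<Rightarrow> bool" where
  "asymptotically_stable A \<longleftrightarrow>
     (\<forall>\<mu>. eigenvalue (map_mat complex_of_real A) \<mu> \<longrightarrow> cmod \<mu> < 1)"

text \<open>Only used for invertible arguments; arbitrary otherwise.\<close>
definition inv_mat :: "real mat \<Rightarrow> real mat" where
  "inv_mat S = the (mat_inverse S)"

text \<open>An \<open>\<infinity> \<times> n\<close> matrix is a function of a row index (counted from \<open>0\<close>) and a column index
  \<open>j < n\<close>; \<open>first_rows N n C\<close> is the matrix $C_N$.\<close>
definition first_rows :: "nat \<Rightarrow> nat \<Rightarrow> (nat \<Rightarrow> nat \<Rightarrow> real) \<Rightarrow> real mat" where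
  "first_rows N n C = mat N n (\<lambda>(i, j). C i j)"

text \<open>Every state can be reached from the origin in finite time by \<open>z(k+1) = A z(k) + B u(k)\<close>.
  For a covariance \<open>Q = G G\<^sup>T\<close> the pairs \<open>(A, Q)\<close> and \<open>(A, G)\<close> have the same reachable states,
  because \<open>Q\<close> and \<open>G\<close> have the same range.\<close>
definition reachable :: "nat \<Rightarrow> real mat \<Rightarrow> real mat \<Rightarrow> bool" where
  "reachable n A B \<longleftrightarrow> (\<forall>\<xi> \<in> carrier_vec n. \<exists>T u z.
     (\<forall>k. u k \<in> carrier_vec (dim_col B)) \<and> z 0 = 0\<^sub>v n \<and>
     (\<forall>k<T. z (Suc k) = A *\<^sub>v z k + B *\<^sub>v u k) \<and> z (T::nat) = \<xi>)"

text \<open>Only the zero initial state of \<open>z(k+1) = A z(k)\<close> gives identically zero output \<open>C z(k)\<close>.\<close>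
definition observable :: "nat \<Rightarrow> real mat \<Rightarrow> (nat \<Rightarrow> nat \<Rightarrow> real) \<Rightarrow> bool" where
  "observable n A C \<longleftrightarrow> (\<forall>\<xi> \<in> carrier_vec n.
     (\<forall>k i. (\<Sum>j<n. C i j * (A ^\<^sub>m k *\<^sub>v \<xi>) $ j) = 0) \<longrightarrow> \<xi> = 0\<^sub>v n)"

section \<open>Second-order random variables\<close>

definition square_integrable :: "'a measure \<Rightarrow> ('a \<Rightarrow> real) \<Rightarrow> bool" where
  "square_integrable M f \<longleftrightarrow> f \<in> borel_measurable M \<and> integrable M (\<lambda>\<omega>. (f \<omega>)\<^sup>2)"

definition zero_mean_finite_variance :: "'a measure \<Rightarrow> ('a \<Rightarrow> real) \<Rightarrow> bool" where
  "zero_mean_finite_variance M f \<longleftrightarrow> square_integrable M f \<and> (\<integral>\<omega>. f \<omega> \<partial>M) = 0"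

text \<open>\<open>\<bbbE>[X X\<^sup>T]\<close>, which is the covariance since all variables have mean zero.\<close>
definition cov_mat :: "'a measure \<Rightarrow> nat \<Rightarrow> ('a \<Rightarrow> real vec) \<Rightarrow> real mat" where
  "cov_mat M d X = mat d d (\<lambda>(i, j). \<integral>\<omega>. X \<omega> $ i * X \<omega> $ j \<partial>M)"

definition mean_square_limit ::
    "'a measure \<Rightarrow> (nat \<Rightarrow> 'a \<Rightarrow> real) \<Rightarrow> ('a \<Rightarrow> real) \<Rightarrow> bool" where
  "mean_square_limit M S s \<longleftrightarrow> (\<forall>m. square_integrable M (S m)) \<and> square_integrable M s \<and>
     (\<lambda>m. \<integral>\<omega>. (S m \<omega> - s \<omega>)\<^sup>2 \<partial>M) \<longlonglongrightarrow> 0"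

text \<open>A family \<open>f t i\<close> of zero-mean processes, indexed by \<open>i \<in> I\<close>.\<close>
definition wide_sense_stationary ::
    "'a measure \<Rightarrow> 'i set \<Rightarrow> (int \<Rightarrow> 'i \<Rightarrow> 'a \<Rightarrow> real) \<Rightarrow> bool" where
  "wide_sense_stationary M I f \<longleftrightarrow> (\<forall>i\<in>I. \<forall>j\<in>I. \<forall>s t h.
     (\<integral>\<omega>. f (s + h) i \<omega> * f (t + h) j \<omega> \<partial>M) = (\<integral>\<omega>. f s i \<omega> * f t j \<omega> \<partial>M))"

section \<open>Idiosyncratic sequences\<close>

text \<open>\<open>a\<^sup>T \<Sigma> a < \<infinity>\<close>, as convergence of the double series.  When \<open>\<Sigma>\<close> is the covariance of \<open>z\<close>, this
  is equivalent to the mean-square convergence of the series \<open>a\<^sup>T z\<close>.\<close>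
definition finite_quadratic_form :: "(nat \<Rightarrow> nat \<Rightarrow> real) \<Rightarrow> (nat \<Rightarrow> real) \<Rightarrow> bool" where
  "finite_quadratic_form \<Sigma> a \<longleftrightarrow>
     (\<exists>q. ((\<lambda>(K, L). \<Sum>i<K. \<Sum>j<L. a i * \<Sigma> i j * a j) \<longlongrightarrow> q) (sequentially \<times>\<^sub>F sequentially))"

text \<open>Here \<open>s m\<close> is the random variable \<open>a\<^sub>m\<^sup>T z\<close>, determined up to almost sure equality.\<close>
definition idiosyncratic :: "'a measure \<Rightarrow> ('a \<Rightarrow> nat \<Rightarrow> real) \<Rightarrow> bool" where
  "idiosyncratic M z \<longleftrightarrow> (\<forall>a s.
     (\<forall>m. summable (\<lambda>k. (a m k)\<^sup>2)) \<and>
     (\<forall>m. finite_quadratic_form (\<lambda>i j. \<integral>\<omega>. z \<omega> i * z \<omega> j \<partial>M) (a m)) \<and>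
     (\<forall>m. mean_square_limit M (\<lambda>K \<omega>. \<Sum>k<K. a m k * z \<omega> k) (s m)) \<and>
     (\<lambda>m. sqrt (\<Sum>k. (a m k)\<^sup>2)) \<longlonglongrightarrow> 0
     \<longrightarrow> mean_square_limit M s (\<lambda>\<omega>. 0))"

section \<open>The model\<close>

text \<open>Observability of \<open>(A, C)\<close> already follows from \<open>strongly_independent\<close>; together with
  reachability it states minimality.\<close>
locale dgfa_model = prob_space M
  for M :: "'a measure"
    and n :: nat
    and A :: "real mat"
    and Q :: "real mat"
    and C :: "nat \<Rightarrow> nat \<Rightarrow> real"
    and x :: "int \<Rightarrow> 'a \<Rightarrow> real vec"
    and v :: "int \<Rightarrow> 'a \<Rightarrow> real vec"
    and y :: "int \<Rightarrow> 'a \<Rightarrow> nat \<Rightarrow> real"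
    and w :: "int \<Rightarrow> 'a \<Rightarrow> nat \<Rightarrow> real" +
  assumes n_pos: "n \<ge> 1"
    and A_carrier: "A \<in> carrier_mat n n"
    and Q_carrier: "Q \<in> carrier_mat n n"
    and x_carrier: "\<And>t \<omega>. x t \<omega> \<in> carrier_vec n"
    and v_carrier: "\<And>t \<omega>. v t \<omega> \<in> carrier_vec n"
    and x_L2: "\<And>t i. i < n \<Longrightarrow> zero_mean_finite_variance M (\<lambda>\<omega>. x t \<omega> $ i)"
    and v_L2: "\<And>t i. i < n \<Longrightarrow> zero_mean_finite_variance M (\<lambda>\<omega>. v t \<omega> $ i)"
    and y_L2: "\<And>t k. zero_mean_finite_variance M (\<lambda>\<omega>. y t \<omega> k)"
    and w_L2: "\<And>t k. zero_mean_finite_variance M (\<lambda>\<omega>. w t \<omega> k)"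
    and state_eq: "\<And>t. AE \<omega> in M. x (t + 1) \<omega> = A *\<^sub>v x t \<omega> + v t \<omega>"
    and output_eq: "\<And>t k. AE \<omega> in M. y t \<omega> k = (\<Sum>j<n. C k j * x t \<omega> $ j) + w t \<omega> k"
    and A_stable: "asymptotically_stable A"
    and v_white: "\<And>s t i j. i < n \<Longrightarrow> j < n \<Longrightarrow>
      (\<integral>\<omega>. v s \<omega> $ i * v t \<omega> $ j \<partial>M) = (if s = t then Q $$ (i, j) else 0)"
    and w_white: "\<And>s t k l. s \<noteq> t \<Longrightarrow> (\<integral>\<omega>. w s \<omega> k * w t \<omega> l \<partial>M) = 0"
    and w_stationary: "wide_sense_stationary M UNIV (\<lambda>t k \<omega>. w t \<omega> k)"
    and v_w_uncorrelated: "\<And>s t i k. i < n \<Longrightarrow> (\<integral>\<omega>. v s \<omega> $ i * w t \<omega> k \<partial>M) = 0"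
    and strongly_independent:
      "filterlim (\<lambda>N. lambda_min ((first_rows N n C)\<^sup>T * first_rows N n C)) at_top sequentially"
    and w_idiosyncratic: "idiosyncratic M (w 0)"
    and xy_stationary: "wide_sense_stationary M ({..<n} <+> UNIV)
      (\<lambda>t. case_sum (\<lambda>i \<omega>. x t \<omega> $ i) (\<lambda>k \<omega>. y t \<omega> k))"
    and A_Q_reachable: "reachable n A Q"
    and A_C_observable: "observable n A C"
    and noise_cov_pos:
      "\<And>N t. N \<ge> 1 \<Longrightarrow> positive_definite N (cov_mat M N (\<lambda>\<omega>. vec N (w t \<omega>)))"

section \<open>Linear estimates\<close>

definition linear_combinations :: "('a \<Rightarrow> real) set \<Rightarrow> ('a \<Rightarrow> real) set" where
  "linear_combinations S = {\<lambda>\<omega>. \<Sum>f\<in>F. c f * f \<omega> | F c. finite F \<and> F \<subseteq> S}"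

definition closed_linear_span :: "'a measure \<Rightarrow> ('a \<Rightarrow> real) set \<Rightarrow> ('a \<Rightarrow> real) set" where
  "closed_linear_span M S =
     {f. \<exists>g. (\<forall>m. g m \<in> linear_combinations S) \<and> mean_square_limit M g f}"

definition best_linear_estimate ::
    "'a measure \<Rightarrow> ('a \<Rightarrow> real) set \<Rightarrow> ('a \<Rightarrow> real) \<Rightarrow> ('a \<Rightarrow> real) \<Rightarrow> bool" where
  "best_linear_estimate M S \<xi> \<eta> \<longleftrightarrow> \<eta> \<in> closed_linear_span M S \<and>
     (\<forall>g \<in> closed_linear_span M S.
        (\<integral>\<omega>. (\<xi> \<omega> - \<eta> \<omega>)\<^sup>2 \<partial>M) \<le> (\<integral>\<omega>. (\<xi> \<omega> - g \<omega>)\<^sup>2 \<partial>M))"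

text \<open>Components \<open>k < N\<close> of \<open>y\<close> over the infinite past up to and including time \<open>t\<close>.\<close>
definition observations ::
    "(int \<Rightarrow> 'a \<Rightarrow> nat \<Rightarrow> real) \<Rightarrow> nat \<Rightarrow> int \<Rightarrow> ('a \<Rightarrow> real) set" where
  "observations y N t = {\<lambda>\<omega>. y s \<omega> k | s k. s \<le> t \<and> k < N}"

text \<open>\<open>X\<close> is (a version of) the best linear estimate of the vector \<open>x(t)\<close> from \<open>y\<^sub>N(s)\<close>, \<open>s \<le> r\<close>.
  The case \<open>r = t\<close> is the filter, \<open>r = t - 1\<close> the one-step predictor.\<close>
definition kalman_estimate ::
    "'a measure \<Rightarrow> nat \<Rightarrow> (int \<Rightarrow> 'a \<Rightarrow> real vec) \<Rightarrow> (int \<Rightarrow> 'a \<Rightarrow> nat \<Rightarrow> real) \<Rightarrow>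
     nat \<Rightarrow> int \<Rightarrow> int \<Rightarrow> ('a \<Rightarrow> real vec) \<Rightarrow> bool" where
  "kalman_estimate M n x y N t r X \<longleftrightarrow> (\<forall>\<omega>. X \<omega> \<in> carrier_vec n) \<and>
     (\<forall>i<n. best_linear_estimate M (observations y N r) (\<lambda>\<omega>. x t \<omega> $ i) (\<lambda>\<omega>. X \<omega> $ i))"

end

theory Submission
  imports Defs
begin

text \<open>Convergence needs only a suboptimal estimate: with \<open>a\<close> the \<open>i\<close>-th row of
  \<open>(C\<^sub>N\<^sup>T C\<^sub>N)\<inverse> C\<^sub>N\<^sup>T\<close> the combination \<open>a \<bullet> y\<^sub>N(t)\<close> estimates \<open>x\<^sub>i(t)\<close> with error \<open>a \<bullet> w\<^sub>N(t)\<close>, and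
  \<open>|a|\<^sup>2 \<le> 1 / \<lambda>\<^sub>m\<^sub>i\<^sub>n(C\<^sub>N\<^sup>T C\<^sub>N) \<longlonglongrightarrow> 0\<close>, so the idiosyncratic property applies to \<open>a\<close> itself and the filter
  does at least as well.

  For \<open>P\<^sub>N > 0\<close>: if \<open>u \<bullet> x(t)\<close> is a limit of combinations of past observations, then, as the noises
  \<open>v(t-1)\<close> and \<open>w(t-1)\<close> are orthogonal to everything else and \<open>R\<^sub>N > 0\<close>, \<open>Q u = 0\<close> and \<open>A\<^sup>T u\<close> has the
  same property at time \<open>t-1\<close>; hence \<open>u\<close> is orthogonal to all reachable states.

  The formula for \<open>\<Pi>\<^sub>N\<close> comes from updating the predictor with the gain \<open>\<Pi>\<^sub>N C\<^sub>N\<^sup>T R\<^sub>N\<inverse>\<close> and the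
  orthogonality principle.\<close>

section \<open>Square-integrable random variables\<close>

text \<open>Random variables are functions here, not classes modulo null sets: \<open>ip\<close> is
  only a semi-inner product, and the model equations hold almost surely. Two estimates are therefore
  never identified; they are compared through their inner products. The estimates are given, so
  their optimality has only to be exploited: minimality over the closed span yields orthogonality of
  the error.

  The obstacle in the positivity proof is that a mean-square limit of combinations of observations
  does not visibly split into a newest and an older part. The approximants are split instead, and a
  bound \<open>R_N >= r I\<close> with \<open>r > 0\<close> controls the coefficients of their
  newest part. This is why \<open>predictable\<close> speaks of approximants with small error and
  not of a limit.

  The model gives \<open>x\<close> as a stationary solution, not as a series in past inputs. Its
  orthogonality to the output noise and to present and future inputs is derived by running the state
  equation backwards: \<open>A^k\<close> tends to 0 while the variance stays constant.\<close>

lemma nonneg_quadratic_discriminant: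
  fixes a b c :: real
  assumes "\<And>t. 0 \<le> a + 2 * t * b + t\<^sup>2 * c"
  shows "b\<^sup>2 \<le> a * c"
proof (cases "c = 0")
  \<comment> \<open>A vanishing leading coefficient has to be covered, because \<open>ip\<close> is
    only semidefinite.\<close>
  case True
  have "b = 0"
  proof (rule ccontr)
    assume "b \<noteq> 0"
    then have "a + 2 * (- (a + 1) / (2 * b)) * b = - 1" by (simp add: field_simps)
    then show False using assms[of "- (a + 1) / (2 * b)"] True by simp
  qed
  with True show ?thesis by simp
next
  case False
  have "0 \<le> c"
  proof (rule ccontr)
    assume "\<not> 0 \<le> c"
    \<comment> \<open>Averaging the values at \<open>t\<close> and \<open>- t\<close> removes the
      linear term; the \<open>t\<close> chosen below makes the remaining expression equal to
      -1.\<close>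
    have "a + 2 * t * b + t\<^sup>2 * c \<ge> 0" "a - 2 * t * b + t\<^sup>2 * c \<ge> 0" for t
      using assms[of t] assms[of "- t"] by simp_all
    then have *: "a + t\<^sup>2 * c \<ge> 0" for t by (smt (verit))
    have "0 \<le> a" using *[of 0] by simp
    with *[of "sqrt ((a + 1) / (- c))"] \<open>\<not> 0 \<le> c\<close> show False by (simp add: field_simps)
  qed
  with False have "0 < c" by simp
  have "0 \<le> a + 2 * (- b / c) * b + (- b / c)\<^sup>2 * c" by (rule assms)
  also have "\<dots> = a - b\<^sup>2 / c" using \<open>0 < c\<close> by (simp add: field_simps power2_eq_square)
  finally show ?thesis using \<open>0 < c\<close> by (simp add: field_simps)
qed

text \<open>The L2 pairing. The integral of a non-integrable function is 0 by convention, so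
  additivity can fail without integrability; hence the \<open>square_integrable\<close> premises of
  the additive rules, while scaling carries none.\<close>

definition ip :: "'a measure \<Rightarrow> ('a \<Rightarrow> real) \<Rightarrow> ('a \<Rightarrow> real) \<Rightarrow> real" where
  "ip M f g = (\<integral>\<omega>. f \<omega> * g \<omega> \<partial>M)"

lemma square_integrable_mult:
  assumes "square_integrable M f" "square_integrable M g"
  shows "integrable M (\<lambda>\<omega>. f \<omega> * g \<omega>)"
proof (rule Bochner_Integration.integrable_bound)
  show "integrable M (\<lambda>\<omega>. (f \<omega>)\<^sup>2 + (g \<omega>)\<^sup>2)"
    using assms unfolding square_integrable_def by auto
  show "(\<lambda>\<omega>. f \<omega> * g \<omega>) \<in> borel_measurable M"
    using assms unfolding square_integrable_def by auto
  have "\<bar>a * b\<bar> \<le> \<bar>a\<^sup>2 + b\<^sup>2\<bar>" for a b :: real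
  proof -
    have "2 * (\<bar>a\<bar> * \<bar>b\<bar>) \<le> a\<^sup>2 + b\<^sup>2" using sum_squares_bound[of "\<bar>a\<bar>" "\<bar>b\<bar>"] by simp
    moreover have "0 \<le> \<bar>a\<bar> * \<bar>b\<bar>" by simp
    ultimately show ?thesis unfolding abs_mult by linarith
  qed
  then show "AE \<omega> in M. norm (f \<omega> * g \<omega>) \<le> norm ((f \<omega>)\<^sup>2 + (g \<omega>)\<^sup>2)" by simp
qed

lemma square_integrable_0 [simp]: "square_integrable M (\<lambda>\<omega>. 0)"
  by (simp add: square_integrable_def)

lemma square_integrable_cmult [simp]:
  "square_integrable M f \<Longrightarrow> square_integrable M (\<lambda>\<omega>. c * f \<omega>)"
  by (auto simp: square_integrable_def power_mult_distrib intro: borel_measurable_times)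

lemma square_integrable_add [simp]:
  assumes "square_integrable M f" "square_integrable M g"
  shows "square_integrable M (\<lambda>\<omega>. f \<omega> + g \<omega>)"
  using assms square_integrable_mult[OF assms]
  by (auto simp: square_integrable_def power2_sum mult.assoc intro!: borel_measurable_add)

lemma square_integrable_diff [simp]:
  assumes "square_integrable M f" "square_integrable M g"
  shows "square_integrable M (\<lambda>\<omega>. f \<omega> - g \<omega>)"
  using assms square_integrable_mult[OF assms]
  by (auto simp: square_integrable_def power2_diff mult.assoc intro!: borel_measurable_diff)

lemma square_integrable_sum [simp]:
  "(\<And>i. i \<in> I \<Longrightarrow> square_integrable M (f i)) \<Longrightarrow> square_integrable M (\<lambda>\<omega>. \<Sum>i\<in>I. f i \<omega>)"
  by (induction I rule: infinite_finite_induct) auto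

lemma ip_commute: "ip M f g = ip M g f"
  by (simp add: ip_def mult.commute)

lemma ip_add_left:
  assumes "square_integrable M f" "square_integrable M g" "square_integrable M h"
  shows "ip M (\<lambda>\<omega>. f \<omega> + g \<omega>) h = ip M f h + ip M g h"
  using square_integrable_mult[OF assms(1,3)] square_integrable_mult[OF assms(2,3)]
  by (simp add: ip_def distrib_right)

lemma ip_diff_left:
  assumes "square_integrable M f" "square_integrable M g" "square_integrable M h"
  shows "ip M (\<lambda>\<omega>. f \<omega> - g \<omega>) h = ip M f h - ip M g h"
  using square_integrable_mult[OF assms(1,3)] square_integrable_mult[OF assms(2,3)]
  by (simp add: ip_def left_diff_distrib)

lemma ip_cmult_left: "ip M (\<lambda>\<omega>. c * f \<omega>) h = c * ip M f h"
  unfolding ip_def by (simp add: mult.assoc)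

lemma ip_0_left [simp]: "ip M (\<lambda>\<omega>. 0) h = 0"
  by (simp add: ip_def)

lemma ip_sum_left:
  assumes "\<And>i. i \<in> I \<Longrightarrow> square_integrable M (f i)" "square_integrable M h"
  shows "ip M (\<lambda>\<omega>. \<Sum>i\<in>I. f i \<omega>) h = (\<Sum>i\<in>I. ip M (f i) h)"
  using assms by (induction I rule: infinite_finite_induct) (auto simp: ip_add_left)

lemma ip_add_right:
  assumes "square_integrable M f" "square_integrable M g" "square_integrable M h"
  shows "ip M h (\<lambda>\<omega>. f \<omega> + g \<omega>) = ip M h f + ip M h g"
  using ip_add_left[OF assms] by (simp add: ip_commute)

lemma ip_diff_right:
  assumes "square_integrable M f" "square_integrable M g" "square_integrable M h"
  shows "ip M h (\<lambda>\<omega>. f \<omega> - g \<omega>) = ip M h f - ip M h g"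
  using ip_diff_left[OF assms] by (simp add: ip_commute)

lemma ip_cmult_right: "ip M h (\<lambda>\<omega>. c * f \<omega>) = c * ip M h f"
  unfolding ip_commute[of M h] by (rule ip_cmult_left)

lemma ip_0_right [simp]: "ip M h (\<lambda>\<omega>. 0) = 0"
  by (simp add: ip_def)

lemma ip_sum_right:
  assumes "\<And>i. i \<in> I \<Longrightarrow> square_integrable M (f i)" "square_integrable M h"
  shows "ip M h (\<lambda>\<omega>. \<Sum>i\<in>I. f i \<omega>) = (\<Sum>i\<in>I. ip M h (f i))"
  unfolding ip_commute[of M h] by (rule ip_sum_left[OF assms])

lemma ip_self_nonneg [simp]: "0 \<le> ip M f f"
  unfolding ip_def by simp

text \<open>The entry point of the model equations, which hold only almost surely. Square
  integrability supplies the measurability that the congruence rule for integrals asks for.\<close>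

lemma ip_cong_AE:
  assumes "AE \<omega> in M. f \<omega> = f' \<omega>" "AE \<omega> in M. g \<omega> = g' \<omega>"
    "square_integrable M f" "square_integrable M f'" "square_integrable M g" "square_integrable M g'"
  shows "ip M f g = ip M f' g'"
  unfolding ip_def
proof (rule integral_cong_AE)
  show "AE \<omega> in M. f \<omega> * g \<omega> = f' \<omega> * g' \<omega>" using assms(1,2) by eventually_elim simp
qed (use assms in \<open>auto simp: square_integrable_def\<close>)

lemma ip_Cauchy_Schwarz:
  assumes f: "square_integrable M f" and g: "square_integrable M g"
  shows "(ip M f g)\<^sup>2 \<le> ip M f f * ip M g g"
proof (rule nonneg_quadratic_discriminant)
  fix t :: real
  let ?h = "\<lambda>\<omega>. f \<omega> + t * g \<omega>"
  have "ip M ?h ?h = ip M f f + 2 * t * ip M f g + t\<^sup>2 * ip M g g"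
    using f g by (simp add: ip_add_left ip_add_right ip_cmult_left ip_cmult_right ip_commute[of M g f]
        power2_eq_square algebra_simps)
  then show "0 \<le> ip M f f + 2 * t * ip M f g + t\<^sup>2 * ip M g g"
    by (metis ip_self_nonneg)
qed

text \<open>Expanding the square of \<open>f - g\<close> bounds the cross term. This replaces the
  triangle inequality and avoids square roots of second moments.\<close>

lemma ip_add_self_le:
  assumes f: "square_integrable M f" and g: "square_integrable M g"
  shows "ip M (\<lambda>\<omega>. f \<omega> + g \<omega>) (\<lambda>\<omega>. f \<omega> + g \<omega>) \<le> 2 * ip M f f + 2 * ip M g g"
proof -
  have "0 \<le> ip M (\<lambda>\<omega>. f \<omega> - g \<omega>) (\<lambda>\<omega>. f \<omega> - g \<omega>)" by simp
  then show ?thesis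
    using f g by (simp add: ip_add_left ip_add_right ip_diff_left ip_diff_right ip_commute[of M g f])
qed

lemma mean_square_limit_ip:
  "mean_square_limit M S s \<longleftrightarrow> (\<forall>m. square_integrable M (S m)) \<and> square_integrable M s \<and>
     (\<lambda>m. ip M (\<lambda>\<omega>. S m \<omega> - s \<omega>) (\<lambda>\<omega>. S m \<omega> - s \<omega>)) \<longlonglongrightarrow> 0"
  by (simp add: mean_square_limit_def ip_def power2_eq_square)

lemma mean_square_limit_add:
  assumes f: "mean_square_limit M F f" and g: "mean_square_limit M G g"
  shows "mean_square_limit M (\<lambda>m \<omega>. F m \<omega> + G m \<omega>) (\<lambda>\<omega>. f \<omega> + g \<omega>)"
proof -
  let ?d = "\<lambda>m \<omega>. F m \<omega> - f \<omega>" and ?e = "\<lambda>m \<omega>. G m \<omega> - g \<omega>"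
  note L = f[unfolded mean_square_limit_ip] g[unfolded mean_square_limit_ip]
  have "(\<lambda>m. ip M (\<lambda>\<omega>. ?d m \<omega> + ?e m \<omega>) (\<lambda>\<omega>. ?d m \<omega> + ?e m \<omega>)) \<longlonglongrightarrow> 0"
  proof (rule tendsto_sandwich[OF _ _ tendsto_const])
    show "(\<lambda>m. 2 * ip M (?d m) (?d m) + 2 * ip M (?e m) (?e m)) \<longlonglongrightarrow> 0"
      using L by (auto intro!: tendsto_eq_intros)
  qed (use L in \<open>auto intro!: ip_add_self_le always_eventually\<close>)
  then show ?thesis
    using L unfolding mean_square_limit_ip add_diff_add by simp
qed

lemma mean_square_limit_cmult:
  assumes f: "mean_square_limit M F f"
  shows "mean_square_limit M (\<lambda>m \<omega>. c * F m \<omega>) (\<lambda>\<omega>. c * f \<omega>)"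
proof -
  note L = f[unfolded mean_square_limit_ip]
  have "(\<lambda>m. ip M (\<lambda>\<omega>. c * (F m \<omega> - f \<omega>)) (\<lambda>\<omega>. c * (F m \<omega> - f \<omega>))) \<longlonglongrightarrow> 0"
    unfolding ip_cmult_left ip_cmult_right using L by (auto intro!: tendsto_eq_intros)
  then show ?thesis
    using L by (simp add: mean_square_limit_ip right_diff_distrib)
qed

text \<open>Since \<open>h\<close> is orthogonal to every \<open>G m\<close>, its pairing with
  \<open>g\<close> is minus its pairing with \<open>G m - g\<close>, which tends to 0 by
  Cauchy-Schwarz.\<close>

lemma mean_square_limit_orthogonal:
  assumes G: "mean_square_limit M G g" and h: "square_integrable M h"
    and orth: "\<And>m. ip M h (G m) = 0"
  shows "ip M h g = 0"
proof -
  note L = G[unfolded mean_square_limit_ip]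
  have "(ip M h g)\<^sup>2 \<le> ip M h h * ip M (\<lambda>\<omega>. G m \<omega> - g \<omega>) (\<lambda>\<omega>. G m \<omega> - g \<omega>)" for m
  proof -
    have "ip M h (\<lambda>\<omega>. G m \<omega> - g \<omega>) = - ip M h g"
      using L h by (simp add: ip_diff_right orth)
    then show ?thesis
      using ip_Cauchy_Schwarz[OF h, of "\<lambda>\<omega>. G m \<omega> - g \<omega>"] L by simp
  qed
  moreover have "(\<lambda>m. ip M h h * ip M (\<lambda>\<omega>. G m \<omega> - g \<omega>) (\<lambda>\<omega>. G m \<omega> - g \<omega>)) \<longlonglongrightarrow> 0"
    using L by (auto intro!: tendsto_eq_intros)
  ultimately have "(ip M h g)\<^sup>2 \<le> 0"
    by (intro LIMSEQ_le_const) auto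
  then show ?thesis by simp
qed

section \<open>Finite combinations of random variables and Gram matrices\<close>

lemma AE_all_less:
  assumes "\<And>i. i < (d :: nat) \<Longrightarrow> AE \<omega> in M. P i \<omega>"
  shows "AE \<omega> in M. \<forall>i<d. P i \<omega>"
proof -
  have "AE \<omega> in M. \<forall>i\<in>{..<d}. P i \<omega>" by (rule AE_finite_allI) (use assms in auto)
  then show ?thesis unfolding Ball_def lessThan_iff .
qed

lemma square_integrable_sum_lessThan [simp]:
  "(\<And>i. i < d \<Longrightarrow> square_integrable M (f i)) \<Longrightarrow> square_integrable M (\<lambda>\<omega>. \<Sum>i<d. f i \<omega>)"
  by (rule square_integrable_sum) auto

lemma ip_sum_cmult_left:
  assumes "\<And>i. i < d \<Longrightarrow> square_integrable M (f i)" "square_integrable M h"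
  shows "ip M (\<lambda>\<omega>. \<Sum>i<d. c i * f i \<omega>) h = (\<Sum>i<d. c i * ip M (f i) h)"
  using assms by (subst ip_sum_left) (auto simp: ip_cmult_left)

lemma ip_sum_cmult_right:
  assumes "\<And>i. i < d \<Longrightarrow> square_integrable M (f i)" "square_integrable M h"
  shows "ip M h (\<lambda>\<omega>. \<Sum>i<d. c i * f i \<omega>) = (\<Sum>i<d. c i * ip M h (f i))"
  using assms by (subst ip_sum_right) (auto simp: ip_cmult_right)

text \<open>Pointwise Cauchy-Schwarz in the index, then integrated. It separates coefficients from
  variables, so that small coefficients force a small combination.\<close>

lemma ip_sum_self_le:
  assumes I: "\<And>i. i \<in> I \<Longrightarrow> square_integrable M (f i)"
  shows "ip M (\<lambda>\<omega>. \<Sum>i\<in>I. c i * f i \<omega>) (\<lambda>\<omega>. \<Sum>i\<in>I. c i * f i \<omega>)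
    \<le> (\<Sum>i\<in>I. (c i)\<^sup>2) * (\<Sum>i\<in>I. ip M (f i) (f i))"
proof -
  have sq: "integrable M (\<lambda>\<omega>. (f i \<omega>)\<^sup>2)" if "i \<in> I" for i
    using I[OF that] by (simp add: square_integrable_def)
  have "ip M (\<lambda>\<omega>. \<Sum>i\<in>I. c i * f i \<omega>) (\<lambda>\<omega>. \<Sum>i\<in>I. c i * f i \<omega>) = (\<integral>\<omega>. (\<Sum>i\<in>I. c i * f i \<omega>)\<^sup>2 \<partial>M)"
    by (simp add: ip_def power2_eq_square)
  also have "\<dots> \<le> (\<integral>\<omega>. (\<Sum>i\<in>I. (c i)\<^sup>2) * (\<Sum>i\<in>I. (f i \<omega>)\<^sup>2) \<partial>M)"
  proof (rule integral_mono)
    have "square_integrable M (\<lambda>\<omega>. \<Sum>i\<in>I. c i * f i \<omega>)" using I by simp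
    then show "integrable M (\<lambda>\<omega>. (\<Sum>i\<in>I. c i * f i \<omega>)\<^sup>2)" by (simp add: square_integrable_def)
    show "integrable M (\<lambda>\<omega>. (\<Sum>i\<in>I. (c i)\<^sup>2) * (\<Sum>i\<in>I. (f i \<omega>)\<^sup>2))"
      using sq by (intro integrable_mult_right Bochner_Integration.integrable_sum)
  qed (rule Cauchy_Schwarz_ineq_sum)
  also have "\<dots> = (\<Sum>i\<in>I. (c i)\<^sup>2) * (\<Sum>i\<in>I. ip M (f i) (f i))"
    using sq by (simp add: ip_def power2_eq_square)
  finally show ?thesis .
qed

text \<open>The bridge between matrix positivity and second moments: covariance matrices are Gram
  matrices for \<open>ip\<close>.\<close>

lemma scalar_prod_gram:
  assumes f: "\<And>i. i < d \<Longrightarrow> square_integrable M (f i)"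
    and u: "u \<in> carrier_vec d" and v: "v \<in> carrier_vec d"
  shows "u \<bullet> (mat d d (\<lambda>(i, j). ip M (f i) (f j)) *\<^sub>v v) =
    ip M (\<lambda>\<omega>. \<Sum>i<d. u $ i * f i \<omega>) (\<lambda>\<omega>. \<Sum>i<d. v $ i * f i \<omega>)"
proof -
  have "square_integrable M (\<lambda>\<omega>. \<Sum>i<d. v $ i * f i \<omega>)" using f by simp
  then show ?thesis using f u v
    by (simp add: ip_sum_cmult_left ip_sum_cmult_right scalar_prod_def atLeast0LessThan mult.commute)
qed

section \<open>Linear spans and best linear estimates\<close>

lemma linear_combinations_0: "(\<lambda>\<omega>. 0) \<in> linear_combinations S"
  unfolding linear_combinations_def by (intro CollectI exI[of _ "{}"]) auto

lemma linear_combinations_superset: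
  assumes "f \<in> S" shows "f \<in> linear_combinations S"
  unfolding linear_combinations_def using assms
  by (intro CollectI exI[of _ "{f}"] exI[of _ "\<lambda>_. 1"]) auto

lemma linear_combinations_cmult:
  assumes "f \<in> linear_combinations S" shows "(\<lambda>\<omega>. a * f \<omega>) \<in> linear_combinations S"
proof -
  from assms obtain F c where F: "f = (\<lambda>\<omega>. \<Sum>g\<in>F. c g * g \<omega>)" "finite F" "F \<subseteq> S"
    unfolding linear_combinations_def by auto
  have "(\<lambda>\<omega>. a * f \<omega>) = (\<lambda>\<omega>. \<Sum>g\<in>F. (a * c g) * g \<omega>)"
    by (simp add: F(1) sum_distrib_left mult.assoc)
  with F(2,3) show ?thesis unfolding linear_combinations_def mem_Collect_eq
    by (intro exI[of _ F] exI[of _ "\<lambda>g. a * c g"] conjI)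
qed

lemma linear_combinations_add:
  assumes "f \<in> linear_combinations S" "g \<in> linear_combinations S"
  shows "(\<lambda>\<omega>. f \<omega> + g \<omega>) \<in> linear_combinations S"
proof -
  from assms(1) obtain F c where F: "f = (\<lambda>\<omega>. \<Sum>h\<in>F. c h * h \<omega>)" "finite F" "F \<subseteq> S"
    unfolding linear_combinations_def by auto
  from assms(2) obtain G d where G: "g = (\<lambda>\<omega>. \<Sum>h\<in>G. d h * h \<omega>)" "finite G" "G \<subseteq> S"
    unfolding linear_combinations_def by auto
  \<comment> \<open>A variable may occur in both sums, so both coefficient functions are extended by
    0 to the union before they are added.\<close>
  let ?k = "\<lambda>h. (if h \<in> F then c h else 0) + (if h \<in> G then d h else 0)"
  have "(\<lambda>\<omega>. f \<omega> + g \<omega>) = (\<lambda>\<omega>. \<Sum>h\<in>F \<union> G. ?k h * h \<omega>)"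
  proof
    fix \<omega>
    have "(\<Sum>h\<in>F \<union> G. (if h \<in> F then c h else 0) * h \<omega>) = (\<Sum>h\<in>F. c h * h \<omega>)"
      by (intro sum.mono_neutral_cong_right) (use F(2) G(2) in auto)
    moreover have "(\<Sum>h\<in>F \<union> G. (if h \<in> G then d h else 0) * h \<omega>) = (\<Sum>h\<in>G. d h * h \<omega>)"
      by (intro sum.mono_neutral_cong_right) (use F(2) G(2) in auto)
    ultimately show "f \<omega> + g \<omega> = (\<Sum>h\<in>F \<union> G. ?k h * h \<omega>)"
      unfolding F(1) G(1) by (simp only: distrib_right sum.distrib)
  qed
  moreover have "finite (F \<union> G)" "F \<union> G \<subseteq> S" using F(2,3) G(2,3) by auto
  ultimately show ?thesis unfolding linear_combinations_def mem_Collect_eq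
    by (intro exI[of _ "F \<union> G"] exI[of _ ?k] conjI)
qed

lemma linear_combinations_sum:
  assumes "\<And>i. i \<in> I \<Longrightarrow> f i \<in> linear_combinations S"
  shows "(\<lambda>\<omega>. \<Sum>i\<in>I. f i \<omega>) \<in> linear_combinations S"
  using assms
  by (induction I rule: infinite_finite_induct)
    (auto simp: linear_combinations_0 intro: linear_combinations_add)

text \<open>Hides the finite set and the coefficients behind the addition of one term at a
  time.\<close>

lemma linear_combinations_induct [consumes 1, case_names zero step]:
  assumes "f \<in> linear_combinations S"
    and "P (\<lambda>\<omega>. 0)"
    and "\<And>c g h. g \<in> S \<Longrightarrow> P h \<Longrightarrow> P (\<lambda>\<omega>. c * g \<omega> + h \<omega>)"
  shows "P f"
proof -
  from assms(1) obtain F c where F: "f = (\<lambda>\<omega>. \<Sum>g\<in>F. c g * g \<omega>)" "finite F" "F \<subseteq> S"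
    unfolding linear_combinations_def by auto
  from F(2,3) have "P (\<lambda>\<omega>. \<Sum>g\<in>F. c g * g \<omega>)"
    by (induction F rule: finite_induct) (auto intro: assms(2,3))
  with F show ?thesis by simp
qed

lemma linear_combinations_square_integrable:
  assumes "f \<in> linear_combinations S" "\<And>g. g \<in> S \<Longrightarrow> square_integrable M g"
  shows "square_integrable M f"
  using assms(1) by (induction rule: linear_combinations_induct) (auto simp: assms(2))

lemma closed_linear_span_square_integrable:
  "f \<in> closed_linear_span M S \<Longrightarrow> square_integrable M f"
  unfolding closed_linear_span_def mean_square_limit_def by auto

lemma linear_combinations_closed_linear_span:
  assumes "f \<in> linear_combinations S" "\<And>g. g \<in> S \<Longrightarrow> square_integrable M g"
  shows "f \<in> closed_linear_span M S"
  unfolding closed_linear_span_def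
  using assms linear_combinations_square_integrable[OF assms]
  by (auto simp: mean_square_limit_def intro!: exI[of _ "\<lambda>_. f"])

lemma closed_linear_span_add:
  assumes "f \<in> closed_linear_span M S" "g \<in> closed_linear_span M S"
  shows "(\<lambda>\<omega>. f \<omega> + g \<omega>) \<in> closed_linear_span M S"
proof -
  from assms obtain F G where "\<forall>m. F m \<in> linear_combinations S" "mean_square_limit M F f"
    "\<forall>m. G m \<in> linear_combinations S" "mean_square_limit M G g"
    unfolding closed_linear_span_def by auto
  then show ?thesis unfolding closed_linear_span_def mem_Collect_eq
    by (intro exI[of _ "\<lambda>m \<omega>. F m \<omega> + G m \<omega>"] conjI)
      (auto intro: mean_square_limit_add linear_combinations_add)
qed

lemma closed_linear_span_cmult:
  assumes "f \<in> closed_linear_span M S"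
  shows "(\<lambda>\<omega>. a * f \<omega>) \<in> closed_linear_span M S"
proof -
  from assms obtain F where "\<forall>m. F m \<in> linear_combinations S" "mean_square_limit M F f"
    unfolding closed_linear_span_def by auto
  then show ?thesis unfolding closed_linear_span_def mem_Collect_eq
    by (intro exI[of _ "\<lambda>m \<omega>. a * F m \<omega>"] conjI)
      (auto intro: mean_square_limit_cmult linear_combinations_cmult)
qed

lemma closed_linear_span_diff:
  assumes "f \<in> closed_linear_span M S" "g \<in> closed_linear_span M S"
  shows "(\<lambda>\<omega>. f \<omega> - g \<omega>) \<in> closed_linear_span M S"
  using closed_linear_span_add[OF assms(1) closed_linear_span_cmult[OF assms(2), of "- 1"]] by simp

lemma closed_linear_span_sum:
  assumes "\<And>g. g \<in> S \<Longrightarrow> square_integrable M g"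
    and "\<And>i. i \<in> I \<Longrightarrow> f i \<in> closed_linear_span M S"
  shows "(\<lambda>\<omega>. \<Sum>i\<in>I. f i \<omega>) \<in> closed_linear_span M S"
  using assms(2)
  by (induction I rule: infinite_finite_induct)
    (auto intro: closed_linear_span_add
      linear_combinations_closed_linear_span[OF linear_combinations_0] assms(1))

lemma closed_linear_span_mono:
  assumes "S \<subseteq> T"
  shows "closed_linear_span M S \<subseteq> closed_linear_span M T"
proof -
  have "linear_combinations S \<subseteq> linear_combinations T"
  proof
    fix f assume "f \<in> linear_combinations S"
    then show "f \<in> linear_combinations T"
    proof (induction rule: linear_combinations_induct)
      case (step c g h)
      with assms have "g \<in> T" by auto
      then have "(\<lambda>\<omega>. c * g \<omega>) \<in> linear_combinations T"
        by (intro linear_combinations_cmult linear_combinations_superset)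
      then show ?case using step(2) by (rule linear_combinations_add)
    qed (rule linear_combinations_0)
  qed
  then show ?thesis unfolding closed_linear_span_def by (auto simp: subset_iff)
qed

lemma closed_linear_span_orthogonal:
  assumes g: "g \<in> closed_linear_span M S" and h: "square_integrable M h"
    and S: "\<And>f. f \<in> S \<Longrightarrow> square_integrable M f" and orth: "\<And>f. f \<in> S \<Longrightarrow> ip M h f = 0"
  shows "ip M h g = 0"
proof -
  have "ip M h f = 0" if "f \<in> linear_combinations S" for f
  proof -
    have "square_integrable M f \<and> ip M h f = 0"
      using that
      by (induction rule: linear_combinations_induct)
        (auto simp: S h orth ip_add_right ip_cmult_right)
    then show ?thesis ..
  qed
  then show ?thesis
    using g h mean_square_limit_orthogonal unfolding closed_linear_span_def by blast
qed

text \<open>Shifting \<open>\<eta>\<close> by a multiple of \<open>g\<close> stays in the span and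
  cannot reduce the error. The resulting quadratic polynomial has constant term 0, so the
  discriminant bound kills its linear coefficient.\<close>

lemma best_linear_estimate_orthogonal:
  assumes best: "best_linear_estimate M S \<xi> \<eta>" and \<xi>: "square_integrable M \<xi>"
    and g: "g \<in> closed_linear_span M S"
  shows "ip M (\<lambda>\<omega>. \<xi> \<omega> - \<eta> \<omega>) g = 0"
proof -
  have \<eta>: "\<eta> \<in> closed_linear_span M S"
    using best unfolding best_linear_estimate_def by simp
  note L2 = \<xi> closed_linear_span_square_integrable[OF \<eta>] closed_linear_span_square_integrable[OF g]
  define e where "e = (\<lambda>\<omega>. \<xi> \<omega> - \<eta> \<omega>)"
  have e: "square_integrable M e" unfolding e_def using L2 by simp
  have "(ip M e g)\<^sup>2 \<le> 0 * ip M g g"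
  proof (rule nonneg_quadratic_discriminant)
    fix t :: real
    let ?h = "\<lambda>\<omega>. \<eta> \<omega> + (- t) * g \<omega>"
    have "?h \<in> closed_linear_span M S"
      by (intro closed_linear_span_add closed_linear_span_cmult \<eta> g)
    then have "ip M e e \<le> ip M (\<lambda>\<omega>. \<xi> \<omega> - ?h \<omega>) (\<lambda>\<omega>. \<xi> \<omega> - ?h \<omega>)"
      using bspec[OF conjunct2[OF best[unfolded best_linear_estimate_def]], of ?h]
      by (simp add: ip_def e_def power2_eq_square)
    also have "(\<lambda>\<omega>. \<xi> \<omega> - ?h \<omega>) = (\<lambda>\<omega>. e \<omega> + t * g \<omega>)"
      by (simp add: e_def algebra_simps)
    also have "ip M \<dots> \<dots> = ip M e e + 2 * t * ip M e g + t\<^sup>2 * ip M g g"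
      using e L2(3) by (simp add: ip_add_left ip_add_right ip_cmult_left ip_cmult_right
          ip_commute[of M g e] power2_eq_square algebra_simps)
    finally show "0 \<le> 0 + 2 * t * ip M e g + t\<^sup>2 * ip M g g" by simp
  qed
  then show ?thesis by (simp add: e_def)
qed

section \<open>Positive definite and stable matrices\<close>

lemma scalar_prod_self_pos:
  fixes u :: "real vec"
  assumes "u \<in> carrier_vec n" "u \<noteq> 0\<^sub>v n"
  shows "0 < u \<bullet> u"
proof -
  from assms obtain i where "i < n" "u $ i \<noteq> 0" by force
  then show ?thesis using assms
    by (auto simp: scalar_prod_def intro!: sum_pos2[of _ i] zero_less_mult_iff[THEN iffD2])
qed

lemma smult_mat_mult_vec:
  fixes B :: "'a :: comm_ring_1 mat"
  assumes "B \<in> carrier_mat m n" "v \<in> carrier_vec n"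
  shows "(a \<cdot>\<^sub>m B) *\<^sub>v v = a \<cdot>\<^sub>v (B *\<^sub>v v)"
  using assms by (intro eq_vecI) (auto simp: scalar_prod_def sum_distrib_left mult.assoc)

lemma scalar_prod_self_nonneg: "0 \<le> (u :: real vec) \<bullet> u"
  by (simp add: scalar_prod_def sum_nonneg)

lemma mult_mat_vec_norm_bound:
  fixes B :: "real mat"
  assumes B: "B \<in> carrier_mat m n"
  obtains b where "0 < b" "\<And>u. u \<in> carrier_vec n \<Longrightarrow> (B *\<^sub>v u) \<bullet> (B *\<^sub>v u) \<le> b * (u \<bullet> u)"
proof
  \<comment> \<open>The squared Frobenius norm of \<open>B\<close>; the added 1 keeps the constant
    positive when \<open>B\<close> is zero.\<close>
  let ?b = "\<Sum>i<m. row B i \<bullet> row B i"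
  show "0 < 1 + ?b"
    using sum_nonneg[of "{..<m}" "\<lambda>i. row B i \<bullet> row B i"] scalar_prod_self_nonneg by fastforce
  fix u :: "real vec" assume u: "u \<in> carrier_vec n"
  have "(row B i \<bullet> u)\<^sup>2 \<le> (row B i \<bullet> row B i) * (u \<bullet> u)" if "i < m" for i
  proof -
    have "dim_vec (row B i) = n" "dim_vec u = n" using B u by auto
    then show ?thesis
      using Cauchy_Schwarz_ineq_sum[of "\<lambda>k. row B i $ k" "\<lambda>k. u $ k" "{0..<n}"]
      by (simp add: scalar_prod_def power2_eq_square)
  qed
  then have "(\<Sum>i<m. (row B i \<bullet> u)\<^sup>2) \<le> (\<Sum>i<m. (row B i \<bullet> row B i) * (u \<bullet> u))"
    by (intro sum_mono) auto
  also have "\<dots> \<le> (1 + ?b) * (u \<bullet> u)"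
    using scalar_prod_self_nonneg[of u] by (simp add: sum_distrib_right distrib_right)
  also have "(\<Sum>i<m. (row B i \<bullet> u)\<^sup>2) = (B *\<^sub>v u) \<bullet> (B *\<^sub>v u)"
    using B by (simp add: scalar_prod_def[of "B *\<^sub>v u"] power2_eq_square atLeast0LessThan)
  finally show "(B *\<^sub>v u) \<bullet> (B *\<^sub>v u) \<le> (1 + ?b) * (u \<bullet> u)" .
qed

lemma symmetric_scalar_prod:
  fixes T :: "real mat"
  assumes "T \<in> carrier_mat n n" "T\<^sup>T = T" "u \<in> carrier_vec n" "v \<in> carrier_vec n"
  shows "u \<bullet> (T *\<^sub>v v) = v \<bullet> (T *\<^sub>v u)"
  using transpose_vec_mult_scalar[OF assms(1,4,3)] assms
  by (metis comm_scalar_prod mult_mat_vec_carrier)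

text \<open>\<open>inv_mat\<close> is \<open>the\<close> of an option. Injectivity makes the
  determinant nonzero, which rules out \<open>None\<close>.\<close>

lemma inverse_mat_exists:
  fixes S :: "real mat"
  assumes S: "S \<in> carrier_mat n n"
    and inj: "\<forall>u \<in> carrier_vec n. S *\<^sub>v u = 0\<^sub>v n \<longrightarrow> u = 0\<^sub>v n"
  shows "inv_mat S \<in> carrier_mat n n" "S * inv_mat S = 1\<^sub>m n" "inv_mat S * S = 1\<^sub>m n"
proof -
  have "det S \<noteq> 0" using det_0_iff_vec_prod_zero_field[OF S] inj by blast
  then have "S \<in> Units (ring_mat TYPE(real) n ())" by (rule det_non_zero_imp_unit[OF S])
  then obtain B where "mat_inverse S = Some B" using mat_inverse(1)[OF S] by fastforce
  with mat_inverse(2)[OF S this]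
  show "inv_mat S \<in> carrier_mat n n" "S * inv_mat S = 1\<^sub>m n" "inv_mat S * S = 1\<^sub>m n"
    by (simp_all add: inv_mat_def)
qed

text \<open>With \<open>v = T u\<close>, the Cauchy--Schwarz inequality of the form \<open>T\<close> bounds \<open>|T u|\<^sup>2\<close> by a multiple
  of \<open>u \<bullet> T u\<close>, and \<open>|u|\<close> is bounded by a multiple of \<open>|T u|\<close>.\<close>
lemma positive_semidefinite_lower_bound:
  fixes T :: "real mat"
  assumes T: "T \<in> carrier_mat n n" and sym: "T\<^sup>T = T"
    and psd: "\<forall>u \<in> carrier_vec n. 0 \<le> u \<bullet> (T *\<^sub>v u)"
    and inj: "\<forall>u \<in> carrier_vec n. T *\<^sub>v u = 0\<^sub>v n \<longrightarrow> u = 0\<^sub>v n"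
  obtains r where "0 < r" "\<And>u. u \<in> carrier_vec n \<Longrightarrow> r * (u \<bullet> u) \<le> u \<bullet> (T *\<^sub>v u)"
proof -
  note B = inverse_mat_exists[OF T inj]
  obtain b where b: "0 < b"
    "\<And>u. u \<in> carrier_vec n \<Longrightarrow> (inv_mat T *\<^sub>v u) \<bullet> (inv_mat T *\<^sub>v u) \<le> b * (u \<bullet> u)"
    using mult_mat_vec_norm_bound[OF B(1)] by blast
  obtain c where c: "0 < c" "\<And>u. u \<in> carrier_vec n \<Longrightarrow> (T *\<^sub>v u) \<bullet> (T *\<^sub>v u) \<le> c * (u \<bullet> u)"
    using mult_mat_vec_norm_bound[OF T] by blast
  \<comment> \<open>Expanding the square of \<open>v - T v\<close> gives this bound with an
    additional factor 1/2, which is dropped.\<close>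
  have upper: "v \<bullet> (T *\<^sub>v v) \<le> (1 + c) * (v \<bullet> v)" if v: "v \<in> carrier_vec n" for v
  proof -
    have Tv: "T *\<^sub>v v \<in> carrier_vec n" using T v by simp
    have "0 \<le> (v - T *\<^sub>v v) \<bullet> (v - T *\<^sub>v v)" by (rule scalar_prod_self_nonneg)
    also have "\<dots> = v \<bullet> v - 2 * (v \<bullet> (T *\<^sub>v v)) + (T *\<^sub>v v) \<bullet> (T *\<^sub>v v)"
      using v Tv comm_scalar_prod[OF v Tv]
      by (simp add: minus_scalar_prod_distrib[of _ n] scalar_prod_minus_distrib[of _ n])
    finally show ?thesis
      using c(2)[OF v] scalar_prod_self_nonneg[of v]
        mult_nonneg_nonneg[OF less_imp_le[OF c(1)] scalar_prod_self_nonneg[of v]]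
      by (simp add: algebra_simps)
  qed
  have "u \<bullet> u \<le> b * (1 + c) * (u \<bullet> (T *\<^sub>v u))" if u: "u \<in> carrier_vec n" for u
  proof -
    define v where "v = T *\<^sub>v u"
    have v: "v \<in> carrier_vec n" using T u by (simp add: v_def)
    have Tv: "T *\<^sub>v v \<in> carrier_vec n" using T v by simp
    have "(v \<bullet> (T *\<^sub>v u))\<^sup>2 \<le> (v \<bullet> (T *\<^sub>v v)) * (u \<bullet> (T *\<^sub>v u))"
    proof (rule nonneg_quadratic_discriminant)
      fix t :: real
      have tu: "t \<cdot>\<^sub>v u \<in> carrier_vec n" using u by simp
      have "0 \<le> (v + t \<cdot>\<^sub>v u) \<bullet> (T *\<^sub>v (v + t \<cdot>\<^sub>v u))"
        by (rule bspec[OF psd]) (use u v in simp)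
      also have "T *\<^sub>v (v + t \<cdot>\<^sub>v u) = T *\<^sub>v v + t \<cdot>\<^sub>v (T *\<^sub>v u)"
        using mult_add_distrib_mat_vec[OF T v tu] mult_mat_vec[OF T u] by simp
      also have "(v + t \<cdot>\<^sub>v u) \<bullet> \<dots> =
          v \<bullet> (T *\<^sub>v v) + t * (v \<bullet> (T *\<^sub>v u)) + t * (u \<bullet> (T *\<^sub>v v)) + t\<^sup>2 * (u \<bullet> (T *\<^sub>v u))"
      proof -
        have Tu: "T *\<^sub>v u \<in> carrier_vec n" using T u by simp
        have "(v + t \<cdot>\<^sub>v u) \<bullet> (T *\<^sub>v v + t \<cdot>\<^sub>v (T *\<^sub>v u)) =
          v \<bullet> (T *\<^sub>v v + t \<cdot>\<^sub>v (T *\<^sub>v u)) + (t \<cdot>\<^sub>v u) \<bullet> (T *\<^sub>v v + t \<cdot>\<^sub>v (T *\<^sub>v u))"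
          by (rule add_scalar_prod_distrib) (use v tu Tv Tu in auto)
        also have "\<dots> = v \<bullet> (T *\<^sub>v v) + t * (v \<bullet> (T *\<^sub>v u)) + t * (u \<bullet> (T *\<^sub>v v))
            + t\<^sup>2 * (u \<bullet> (T *\<^sub>v u))"
          using v u Tv Tu T by (simp add: scalar_prod_add_distrib[of _ n] power2_eq_square algebra_simps)
        finally show ?thesis .
      qed
      finally show "0 \<le> v \<bullet> (T *\<^sub>v v) + 2 * t * (v \<bullet> (T *\<^sub>v u)) + t\<^sup>2 * (u \<bullet> (T *\<^sub>v u))"
        using symmetric_scalar_prod[OF T sym u v] by simp
    qed
    also have "\<dots> \<le> ((1 + c) * (v \<bullet> v)) * (u \<bullet> (T *\<^sub>v u))"
      by (rule mult_right_mono[OF upper[OF v] bspec[OF psd u]])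
    finally have "(v \<bullet> v) * (v \<bullet> v) \<le> (v \<bullet> v) * ((1 + c) * (u \<bullet> (T *\<^sub>v u)))"
      unfolding v_def[symmetric] power2_eq_square by (simp add: algebra_simps)
    \<comment> \<open>Needed for cancelling \<open>v \<bullet> v\<close>: when that factor is 0, the
      claim reduces to this inequality.\<close>
    moreover have "0 \<le> (1 + c) * (u \<bullet> (T *\<^sub>v u))" using c bspec[OF psd u] by simp
    ultimately have vv: "v \<bullet> v \<le> (1 + c) * (u \<bullet> (T *\<^sub>v u))"
      using scalar_prod_self_nonneg[of v] by (cases "v \<bullet> v = 0") (auto simp: mult_le_cancel_left)
    have "u = inv_mat T *\<^sub>v v"
      unfolding v_def using assoc_mult_mat_vec[OF B(1) T u] B(3) u by simp
    then have "u \<bullet> u \<le> b * (v \<bullet> v)" using b(2)[OF v] by simp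
    also have "\<dots> \<le> b * ((1 + c) * (u \<bullet> (T *\<^sub>v u)))" using vv b(1) by simp
    finally show ?thesis by (simp add: mult.assoc)
  qed
  moreover have "0 < b * (1 + c)" using b c by simp
  ultimately show thesis
    by (intro that[of "1 / (b * (1 + c))"]) (auto simp: field_simps)
qed

section \<open>Positive definite matrices: lower bounds, inverses and congruences\<close>

lemma positive_definite_inj:
  assumes "positive_definite n S"
  shows "\<forall>u \<in> carrier_vec n. S *\<^sub>v u = 0\<^sub>v n \<longrightarrow> u = 0\<^sub>v n"
  using assms unfolding positive_definite_def by fastforce

lemma positive_definite_carrier: "positive_definite n S \<Longrightarrow> S \<in> carrier_mat n n"
  unfolding positive_definite_def by simp

lemma positive_definite_nonneg:
  assumes "positive_definite n S" "u \<in> carrier_vec n"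
  shows "0 \<le> u \<bullet> (S *\<^sub>v u)"
  using assms by (cases "u = 0\<^sub>v n") (force simp: positive_definite_def)+

lemma positive_definite_lower_bound:
  assumes "positive_definite n S"
  obtains r where "0 < r" "\<And>u. u \<in> carrier_vec n \<Longrightarrow> r * (u \<bullet> u) \<le> u \<bullet> (S *\<^sub>v u)"
proof -
  have "S \<in> carrier_mat n n" "S\<^sup>T = S" using assms by (auto simp: positive_definite_def)
  with positive_semidefinite_lower_bound[OF this] positive_definite_nonneg[OF assms]
    positive_definite_inj[OF assms] that show thesis by blast
qed

text \<open>With \<open>u = S v\<close>, the form of the inverse at \<open>u\<close> is the form of
  \<open>S\<close> at \<open>v\<close>. Symmetry follows by inserting \<open>S * inv_mat S\<close>
  after the transposed inverse.\<close>

lemma positive_definite_inverse: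
  assumes S: "positive_definite n S"
  shows "inv_mat S \<in> carrier_mat n n" "S * inv_mat S = 1\<^sub>m n" "inv_mat S * S = 1\<^sub>m n"
    "positive_definite n (inv_mat S)"
proof -
  have Sc: "S \<in> carrier_mat n n" and sym: "S\<^sup>T = S" using S by (auto simp: positive_definite_def)
  note B = inverse_mat_exists[OF Sc positive_definite_inj[OF S]]
  show "inv_mat S \<in> carrier_mat n n" "S * inv_mat S = 1\<^sub>m n" "inv_mat S * S = 1\<^sub>m n" by fact+
  have "(inv_mat S)\<^sup>T = (inv_mat S)\<^sup>T * (S * inv_mat S)" using B by simp
  also have "\<dots> = ((inv_mat S)\<^sup>T * S) * inv_mat S" using B Sc by (simp add: assoc_mult_mat[of _ n n _ n _ n])
  also have "(inv_mat S)\<^sup>T * S = (S * inv_mat S)\<^sup>T" using transpose_mult[OF Sc B(1)] sym by simp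
  finally have symB: "(inv_mat S)\<^sup>T = inv_mat S" using B by simp
  have "0 < u \<bullet> (inv_mat S *\<^sub>v u)" if u: "u \<in> carrier_vec n" "u \<noteq> 0\<^sub>v n" for u
  proof -
    define v where "v = inv_mat S *\<^sub>v u"
    have v: "v \<in> carrier_vec n" using B u by (simp add: v_def)
    have Sv: "S *\<^sub>v v = u" unfolding v_def using assoc_mult_mat_vec[OF Sc B(1) u(1)] B(2) u by simp
    have "v \<noteq> 0\<^sub>v n" using Sv u Sc by auto
    then have "0 < v \<bullet> (S *\<^sub>v v)" using S v unfolding positive_definite_def by blast
    then show ?thesis unfolding Sv using comm_scalar_prod[OF v u(1)] v_def by simp
  qed
  with B(1) symB show "positive_definite n (inv_mat S)" unfolding positive_definite_def by auto
qed

text \<open>Meant for \<open>S\<close> the inverse of \<open>P_N\<close> and \<open>T\<close> the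
  inverse of \<open>R_N\<close>, so that the sum is the matrix inverted in the formula for the
  filter covariance. Strict positivity comes from \<open>S\<close>, since \<open>C\<close> may have
  a kernel.\<close>

lemma positive_definite_add_congruence:
  assumes S: "positive_definite n S" and T: "positive_definite m T" and C: "C \<in> carrier_mat m n"
  shows "positive_definite n (S + C\<^sup>T * T * C)"
  unfolding positive_definite_def
proof (intro conjI ballI impI)
  have Sc: "S \<in> carrier_mat n n" "S\<^sup>T = S" and Tc: "T \<in> carrier_mat m m" "T\<^sup>T = T"
    using S T by (auto simp: positive_definite_def)
  have Ct: "C\<^sup>T \<in> carrier_mat n m" using C by simp
  have CT: "C\<^sup>T * T \<in> carrier_mat n m" using C Tc by simp
  show "S + C\<^sup>T * T * C \<in> carrier_mat n n" using Sc Tc C by simp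
  have "(C\<^sup>T * T * C)\<^sup>T = C\<^sup>T * (C\<^sup>T * T)\<^sup>T" by (rule transpose_mult[OF CT C])
  also have "(C\<^sup>T * T)\<^sup>T = T * C" using transpose_mult[OF Ct Tc(1)] Tc by simp
  also have "C\<^sup>T * (T * C) = C\<^sup>T * T * C" using C Tc by simp
  finally show "(S + C\<^sup>T * T * C)\<^sup>T = S + C\<^sup>T * T * C"
    using transpose_add[of S n n "C\<^sup>T * T * C"] Sc C Tc by simp
  fix u :: "real vec" assume u: "u \<in> carrier_vec n" "u \<noteq> 0\<^sub>v n"
  have Cu: "C *\<^sub>v u \<in> carrier_vec m" using C u by simp
  have TCu: "T *\<^sub>v (C *\<^sub>v u) \<in> carrier_vec m" using Cu Tc by simp
  have CTC: "C\<^sup>T * T * C \<in> carrier_mat n n" using CT C by simp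
  have "u \<bullet> ((S + C\<^sup>T * T * C) *\<^sub>v u) = u \<bullet> (S *\<^sub>v u) + u \<bullet> ((C\<^sup>T * T * C) *\<^sub>v u)"
    unfolding add_mult_distrib_mat_vec[OF Sc(1) CTC u(1)]
    by (rule scalar_prod_add_distrib[OF u(1)]) (use Sc CTC u in auto)
  also have "(C\<^sup>T * T * C) *\<^sub>v u = C\<^sup>T *\<^sub>v (T *\<^sub>v (C *\<^sub>v u))"
    using assoc_mult_mat_vec[OF CT C u(1)] assoc_mult_mat_vec[OF Ct Tc(1) Cu] by simp
  also have "u \<bullet> (C\<^sup>T *\<^sub>v (T *\<^sub>v (C *\<^sub>v u))) = (C *\<^sub>v u) \<bullet> (T *\<^sub>v (C *\<^sub>v u))"
    using transpose_vec_mult_scalar[OF C u(1) TCu] comm_scalar_prod[OF u(1), of "C\<^sup>T *\<^sub>v (T *\<^sub>v (C *\<^sub>v u))"]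
      comm_scalar_prod[OF Cu TCu] Ct TCu by simp
  finally show "0 < u \<bullet> ((S + C\<^sup>T * T * C) *\<^sub>v u)"
    using positive_definite_nonneg[OF T Cu] S u unfolding positive_definite_def by fastforce
qed

text \<open>The infimum \<open>m\<close> of \<open>u \<bullet> S u\<close> over unit vectors is an eigenvalue: otherwise \<open>S - m\<close> would be
  injective, hence bounded below on unit vectors by a positive number.\<close>
lemma lambda_min_le_Rayleigh:
  fixes S :: "real mat"
  assumes S: "S \<in> carrier_mat n n" and sym: "S\<^sup>T = S" and u: "u \<in> carrier_vec n"
  shows "lambda_min S * (u \<bullet> u) \<le> u \<bullet> (S *\<^sub>v u)"
proof (cases "u = 0\<^sub>v n")
  case True
  then show ?thesis using S by (simp add: scalar_prod_left_zero[of _ n])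
next
  case False
  \<comment> \<open>The unit sphere; it is nonempty because \<open>u\<close> is nonzero in this
    case.\<close>
  define V where "V = {v :: real vec. v \<in> carrier_vec n \<and> v \<bullet> v = 1}"
  define m where "m = Inf ((\<lambda>v. v \<bullet> (S *\<^sub>v v)) ` V)"
  obtain c where c: "0 < c" "\<And>u. u \<in> carrier_vec n \<Longrightarrow> (S *\<^sub>v u) \<bullet> (S *\<^sub>v u) \<le> c * (u \<bullet> u)"
    using mult_mat_vec_norm_bound[OF S] by blast
  have normalise: "(1 / sqrt (v \<bullet> v)) \<cdot>\<^sub>v v \<in> V" if "v \<in> carrier_vec n" "v \<noteq> 0\<^sub>v n" for v
    using that scalar_prod_self_pos[OF that] unfolding V_def by (auto simp: field_simps)
  have ne: "V \<noteq> {}" using normalise[OF u False] by auto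
  have bdd: "bdd_below ((\<lambda>v. v \<bullet> (S *\<^sub>v v)) ` V)"
  \<comment> \<open>Expanding the square of \<open>v + S v\<close> at a unit vector bounds the form
    below by \<open>- (1 + c) / 2\<close>.\<close>
  proof (rule bdd_belowI2[of _ "- (1 + c)"])
    fix v assume "v \<in> V"
    then have v: "v \<in> carrier_vec n" and 1: "v \<bullet> v = 1" by (auto simp: V_def)
    have Sv: "S *\<^sub>v v \<in> carrier_vec n" using S v by simp
    have "0 \<le> (v + S *\<^sub>v v) \<bullet> (v + S *\<^sub>v v)" by (rule scalar_prod_self_nonneg)
    also have "\<dots> = v \<bullet> v + 2 * (v \<bullet> (S *\<^sub>v v)) + (S *\<^sub>v v) \<bullet> (S *\<^sub>v v)"
      using v Sv comm_scalar_prod[OF v Sv]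
      by (simp add: add_scalar_prod_distrib[of _ n] scalar_prod_add_distrib[of _ n])
    finally show "- (1 + c) \<le> v \<bullet> (S *\<^sub>v v)"
      using c(2)[OF v] c(1) 1 by simp
  qed
  have m: "m * (v \<bullet> v) \<le> v \<bullet> (S *\<^sub>v v)" if v: "v \<in> carrier_vec n" for v
  proof (cases "v = 0\<^sub>v n")
    case True
    then show ?thesis using S by (simp add: scalar_prod_left_zero[of _ n])
  next
    case False
    note p = scalar_prod_self_pos[OF v False]
    let ?s = "1 / sqrt (v \<bullet> v)"
    have "m \<le> (?s \<cdot>\<^sub>v v) \<bullet> (S *\<^sub>v (?s \<cdot>\<^sub>v v))"
      unfolding m_def by (rule cINF_lower[OF bdd normalise[OF v False]])
    also have "\<dots> = (v \<bullet> (S *\<^sub>v v)) / (v \<bullet> v)"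
      using v S p by (simp add: mult_mat_vec[OF S v] field_simps)
    finally show ?thesis using p by (simp add: field_simps)
  qed
  define T where "T = S - m \<cdot>\<^sub>m 1\<^sub>m n"
  have T: "T \<in> carrier_mat n n"
    unfolding T_def by (intro minus_carrier_mat smult_carrier_mat one_carrier_mat)
  have symT: "T\<^sup>T = T" proof (rule eq_matI)
    fix i j assume "i < dim_row T" "j < dim_col T"
    moreover have "S $$ (i, j) = S\<^sup>T $$ (i, j)" by (simp add: sym)
    ultimately show "T\<^sup>T $$ (i, j) = T $$ (i, j)" unfolding T_def using S by auto
  qed (use T in auto)
  have Tv: "T *\<^sub>v v = S *\<^sub>v v - m \<cdot>\<^sub>v v" if "v \<in> carrier_vec n" for v
    unfolding T_def using S that minus_mult_distrib_mat_vec[OF S, of "m \<cdot>\<^sub>m 1\<^sub>m n" v]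
    by (auto simp: smult_mat_mult_vec[of _ n n])
  have vTv: "v \<bullet> (T *\<^sub>v v) = v \<bullet> (S *\<^sub>v v) - m * (v \<bullet> v)" if v: "v \<in> carrier_vec n" for v
    unfolding Tv[OF v] using v S by (simp add: scalar_prod_minus_distrib[of _ n])
  have "\<exists>v. v \<in> carrier_vec n \<and> v \<noteq> 0\<^sub>v n \<and> T *\<^sub>v v = 0\<^sub>v n"
  proof (rule ccontr)
    assume "\<not> ?thesis"
    then have inj: "\<forall>v \<in> carrier_vec n. T *\<^sub>v v = 0\<^sub>v n \<longrightarrow> v = 0\<^sub>v n" by blast
    have psdT: "\<forall>v \<in> carrier_vec n. 0 \<le> v \<bullet> (T *\<^sub>v v)" using m vTv by simp
    obtain r where r: "0 < r" "\<And>v. v \<in> carrier_vec n \<Longrightarrow> r * (v \<bullet> v) \<le> v \<bullet> (T *\<^sub>v v)"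
      using positive_semidefinite_lower_bound[OF T symT _ inj] psdT by blast
    have "m + r \<le> v \<bullet> (S *\<^sub>v v)" if "v \<in> V" for v
      using r(2)[of v] vTv[of v] that by (simp add: V_def)
    then have "m + r \<le> m" unfolding m_def by (intro cINF_greatest[OF ne])
    with r(1) show False by simp
  qed
  then obtain v where v: "v \<in> carrier_vec n" "v \<noteq> 0\<^sub>v n" "T *\<^sub>v v = 0\<^sub>v n" by blast
  have "S *\<^sub>v v = m \<cdot>\<^sub>v v"
  proof (rule eq_vecI)
    fix i assume i: "i < dim_vec (m \<cdot>\<^sub>v v)"
    have "(S *\<^sub>v v - m \<cdot>\<^sub>v v) $ i = 0\<^sub>v n $ i" using v(3) Tv[OF v(1)] by simp
    then show "(S *\<^sub>v v) $ i = (m \<cdot>\<^sub>v v) $ i" using i v S by simp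
  qed (use v S in simp)
  \<comment> \<open>This also shows that the spectrum is nonempty, so that \<open>Min\<close> in
    \<open>lambda_min\<close> is a genuine minimum.\<close>
  then have "m \<in> spectrum S"
    using v S unfolding spectrum_def eigenvalue_def eigenvector_def by auto
  then have "lambda_min S \<le> m"
    unfolding lambda_min_def by (intro Min_le card_finite_spectrum(1)[OF S])
  then show ?thesis using m[OF u] mult_right_mono[OF _ scalar_prod_self_nonneg[of u]] by (meson order_trans)
qed

section \<open>Powers of a stable matrix\<close>

lemma smult_pow_mat:
  fixes B :: "'a :: field mat"
  assumes B: "B \<in> carrier_mat n n"
  shows "(a \<cdot>\<^sub>m B) ^\<^sub>m k = a ^ k \<cdot>\<^sub>m (B ^\<^sub>m k)"
proof (induction k)
  case 0
  show ?case using B by (intro eq_matI) auto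
next
  case (Suc k)
  have Bk: "B ^\<^sub>m k \<in> carrier_mat n n" using B by (rule pow_carrier_mat)
  have "(a \<cdot>\<^sub>m B) ^\<^sub>m Suc k = (a ^ k \<cdot>\<^sub>m (B ^\<^sub>m k)) * (a \<cdot>\<^sub>m B)" by (simp add: Suc)
  also have "\<dots> = a ^ k \<cdot>\<^sub>m (B ^\<^sub>m k * (a \<cdot>\<^sub>m B))"
    by (rule mult_smult_assoc_mat[OF Bk smult_carrier_mat[OF B]])
  also have "B ^\<^sub>m k * (a \<cdot>\<^sub>m B) = a \<cdot>\<^sub>m (B ^\<^sub>m k * B)"
    by (rule mult_smult_distrib[OF Bk B])
  also have "a ^ k \<cdot>\<^sub>m (a \<cdot>\<^sub>m (B ^\<^sub>m k * B)) = a ^ Suc k \<cdot>\<^sub>m (B ^\<^sub>m k * B)"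
    by (intro eq_matI) (simp_all add: ac_simps)
  finally show ?case by simp
qed

text \<open>The powers of \<open>A / r\<close> stay bounded for every \<open>r\<close> above the spectral radius; take \<open>r < 1\<close>.\<close>
lemma asymptotically_stable_powers_tendsto_0:
  assumes A: "A \<in> carrier_mat n n" and stable: "asymptotically_stable A" and ij: "i < n" "j < n"
  shows "(\<lambda>k. (A ^\<^sub>m k) $$ (i, j)) \<longlonglongrightarrow> 0"
proof -
  have n: "n > 0" using ij by simp
  define B where "B = map_mat complex_of_real A"
  have B: "B \<in> carrier_mat n n" using A by (simp add: B_def)
  \<comment> \<open>The midpoint between the spectral radius and 1, hence strictly above the one and
    strictly below the other.\<close>
  define r where "r = (1 + spectral_radius B) / 2"
  have "spectral_radius B \<in> norm ` spectrum B" by (rule spectral_radius_mem_max(1)[OF B n])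
  then have "0 \<le> spectral_radius B" "spectral_radius B < 1"
    using stable unfolding asymptotically_stable_def spectrum_def B_def by auto
  then have r: "0 < r" "r < 1" "spectral_radius B < r" by (auto simp: r_def)
  define B' where "B' = complex_of_real (1 / r) \<cdot>\<^sub>m B"
  have B': "B' \<in> carrier_mat n n" using B by (simp add: B'_def)
  have "spectral_radius B' \<in> norm ` spectrum B'" by (rule spectral_radius_mem_max(1)[OF B' n])
  then obtain \<mu> where \<mu>: "spectral_radius B' = norm \<mu>" "eigenvalue B' \<mu>" unfolding spectrum_def by auto
  then obtain v where v: "v \<in> carrier_vec n" "v \<noteq> 0\<^sub>v n" "B' *\<^sub>v v = \<mu> \<cdot>\<^sub>v v"
    using B' unfolding eigenvalue_def eigenvector_def by auto
  \<comment> \<open>An eigenvalue \<open>\<mu>\<close> of \<open>B / r\<close> gives the eigenvalue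
    \<open>r * \<mu>\<close> of \<open>B\<close>. Applied to a \<open>\<mu>\<close> of largest
    modulus, this puts the spectral radius of \<open>B'\<close> below 1, which bounds the powers of
    \<open>B'\<close> uniformly.\<close>
  have "B *\<^sub>v v = complex_of_real r \<cdot>\<^sub>v (B' *\<^sub>v v)"
    unfolding B'_def using B v(1) r
    by (simp add: smult_mat_mult_vec[of _ n n] smult_smult_assoc)
  also have "\<dots> = (complex_of_real r * \<mu>) \<cdot>\<^sub>v v" unfolding v(3) by (simp add: smult_smult_assoc)
  finally have "complex_of_real r * \<mu> \<in> spectrum B"
    using v B unfolding spectrum_def eigenvalue_def eigenvector_def by auto
  then have "norm (complex_of_real r * \<mu>) \<le> spectral_radius B"
    by (intro spectral_radius_mem_max(2)[OF B n] imageI)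
  moreover have "norm (complex_of_real r * \<mu>) = r * norm \<mu>" using r by (simp add: norm_mult)
  ultimately have "r * norm \<mu> < r * 1" using r by linarith
  then have "spectral_radius B' < 1" using r \<mu>(1) by (simp only: mult_less_cancel_left_pos[OF r(1)])
  then obtain c where c: "\<And>k. norm_bound (B' ^\<^sub>m k) c"
    using spectral_radius_jnf_norm_bound_less_1_upper_triangular[OF B'] by auto
  have bound: "norm ((A ^\<^sub>m k) $$ (i, j)) \<le> r ^ k * c" for k
  proof -
    have Ak: "A ^\<^sub>m k \<in> carrier_mat n n" using A by (rule pow_carrier_mat)
    have Bk: "B ^\<^sub>m k \<in> carrier_mat n n" using B by (rule pow_carrier_mat)
    have "B ^\<^sub>m k = map_mat complex_of_real (A ^\<^sub>m k)"
      unfolding B_def by (rule of_real_hom.mat_hom_pow[OF A, symmetric])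
    then have "(B' ^\<^sub>m k) $$ (i, j) = complex_of_real ((1 / r) ^ k * (A ^\<^sub>m k) $$ (i, j))"
      unfolding B'_def smult_pow_mat[OF B] using carrier_matD[OF Ak] carrier_matD[OF Bk] ij by simp
    moreover have "norm ((B' ^\<^sub>m k) $$ (i, j)) \<le> c"
      using c[of k] ij carrier_matD[OF pow_carrier_mat[OF B', of k]] unfolding norm_bound_def by metis
    ultimately have "\<bar>(1 / r) ^ k * (A ^\<^sub>m k) $$ (i, j)\<bar> \<le> c" by (simp only: norm_of_real)
    then show ?thesis using r by (simp add: abs_mult power_one_over field_simps)
  qed
  have "(\<lambda>k. r ^ k * c) \<longlonglongrightarrow> 0" using r by (intro tendsto_mult_left_zero LIMSEQ_power_zero) auto
  then show ?thesis by (rule Lim_null_comparison[OF always_eventually, rotated]) (use bound in blast)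
qed

lemma index_mult_mat_sum:
  fixes A B :: "'b :: semiring_0 mat"
  assumes "A \<in> carrier_mat m n" "B \<in> carrier_mat n p" "i < m" "j < p"
  shows "(A * B) $$ (i, j) = (\<Sum>k<n. A $$ (i, k) * B $$ (k, j))"
  using assms by (simp add: scalar_prod_def atLeast0LessThan)

section \<open>Second moments of the model\<close>

context dgfa_model
begin

text \<open>Scalar components with the sample point as last argument, so that \<open>X t i\<close>
  itself can be passed to \<open>ip\<close>.\<close>

definition X :: "int \<Rightarrow> nat \<Rightarrow> 'a \<Rightarrow> real" where "X t i = (\<lambda>\<omega>. x t \<omega> $ i)"
definition V :: "int \<Rightarrow> nat \<Rightarrow> 'a \<Rightarrow> real" where "V t i = (\<lambda>\<omega>. v t \<omega> $ i)"
definition Y :: "int \<Rightarrow> nat \<Rightarrow> 'a \<Rightarrow> real" where "Y t k = (\<lambda>\<omega>. y t \<omega> k)"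
definition W :: "int \<Rightarrow> nat \<Rightarrow> 'a \<Rightarrow> real" where "W t k = (\<lambda>\<omega>. w t \<omega> k)"

lemma L2 [simp]:
  "i < n \<Longrightarrow> square_integrable M (X t i)"
  "i < n \<Longrightarrow> square_integrable M (V t i)"
  "square_integrable M (Y t k)"
  "square_integrable M (W t k)"
  using x_L2 v_L2 y_L2 w_L2 unfolding X_def V_def Y_def W_def zero_mean_finite_variance_def by auto

lemma state_AE:
  assumes "i < n"
  shows "AE \<omega> in M. X (t + 1) i \<omega> = (\<Sum>j<n. A $$ (i, j) * X t j \<omega>) + V t i \<omega>"
  using state_eq[of t]
proof eventually_elim
  case (elim \<omega>)
  then show ?case
    using assms A_carrier x_carrier[of t \<omega>] v_carrier[of t \<omega>]
    by (simp add: X_def V_def scalar_prod_def atLeast0LessThan)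
qed

lemma output_AE: "AE \<omega> in M. Y t k \<omega> = (\<Sum>j<n. C k j * X t j \<omega>) + W t k \<omega>"
  using output_eq[of t k] by (simp add: Y_def X_def W_def)

lemma ip_X_step:
  assumes i: "i < n" and h: "square_integrable M h"
  shows "ip M (X (t + 1) i) h = (\<Sum>j<n. A $$ (i, j) * ip M (X t j) h) + ip M (V t i) h"
proof -
  have L: "square_integrable M (\<lambda>\<omega>. \<Sum>j<n. A $$ (i, j) * X t j \<omega>)" by simp
  have "ip M (X (t + 1) i) h = ip M (\<lambda>\<omega>. (\<Sum>j<n. A $$ (i, j) * X t j \<omega>) + V t i \<omega>) h"
    by (rule ip_cong_AE[OF state_AE[OF i]]) (use i h in simp_all)
  also have "\<dots> = (\<Sum>j<n. A $$ (i, j) * ip M (X t j) h) + ip M (V t i) h"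
    using i h by (simp add: ip_add_left[OF L] ip_sum_cmult_left)
  finally show ?thesis .
qed

lemma ip_Y:
  assumes h: "square_integrable M h"
  shows "ip M (Y t k) h = (\<Sum>j<n. C k j * ip M (X t j) h) + ip M (W t k) h"
proof -
  have L: "square_integrable M (\<lambda>\<omega>. \<Sum>j<n. C k j * X t j \<omega>)" by simp
  have "ip M (Y t k) h = ip M (\<lambda>\<omega>. (\<Sum>j<n. C k j * X t j \<omega>) + W t k \<omega>) h"
    by (rule ip_cong_AE[OF output_AE]) (use h in simp_all)
  also have "\<dots> = (\<Sum>j<n. C k j * ip M (X t j) h) + ip M (W t k) h"
    using h by (simp add: ip_add_left[OF L] ip_sum_cmult_left)
  finally show ?thesis .
qed

lemma ip_X_stationary:
  assumes "i < n"
  shows "ip M (X t i) (X t i) = ip M (X 0 i) (X 0 i)"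
proof -
  have "Inl i \<in> {..<n} <+> (UNIV :: nat set)" using assms by auto
  from xy_stationary[unfolded wide_sense_stationary_def, rule_format, OF this this, of 0 t 0]
  show ?thesis by (simp add: ip_def X_def)
qed

text \<open>Unrolls the state equation \<open>k\<close> steps into the past; every input that
  appears has a time before \<open>t\<close> and is orthogonal to \<open>h\<close> by
  assumption.\<close>

lemma ip_X_iterate:
  assumes h: "square_integrable M h" and orth: "\<And>s j. s < t \<Longrightarrow> j < n \<Longrightarrow> ip M (V s j) h = 0"
    and i: "i < n"
  shows "ip M (X t i) h = (\<Sum>j<n. (A ^\<^sub>m k) $$ (i, j) * ip M (X (t - int k) j) h)"
proof (induction k)
  case 0
  have "(\<Sum>j<n. (if i = j then 1 else 0) * ip M (X t j) h) = ip M (X t i) h"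
    using i by (simp add: if_distrib[of "\<lambda>c. c * _"] sum.delta cong: if_cong)
  then show ?case using A_carrier i by simp
next
  case (Suc k)
  have Ak: "A ^\<^sub>m k \<in> carrier_mat n n" using A_carrier by (rule pow_carrier_mat)
  let ?s = "t - int (Suc k)"
  have "ip M (X (t - int k) j) h = (\<Sum>l<n. A $$ (j, l) * ip M (X ?s l) h)" if "j < n" for j
    using ip_X_step[OF that h, of ?s] orth[of ?s j] that by simp
  then have "ip M (X t i) h =
      (\<Sum>j<n. \<Sum>l<n. (A ^\<^sub>m k) $$ (i, j) * (A $$ (j, l) * ip M (X ?s l) h))"
    unfolding Suc by (simp add: sum_distrib_left)
  also have "\<dots> = (\<Sum>l<n. \<Sum>j<n. (A ^\<^sub>m k) $$ (i, j) * (A $$ (j, l) * ip M (X ?s l) h))"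
    by (rule sum.swap)
  also have "\<dots> = (\<Sum>l<n. (A ^\<^sub>m Suc k) $$ (i, l) * ip M (X ?s l) h)"
    using index_mult_mat_sum[OF Ak A_carrier i]
    by (intro sum.cong) (simp_all add: sum_distrib_right mult.assoc)
  finally show ?case .
qed

text \<open>The state is a limit of combinations of past inputs, because \<open>A\<^sup>k \<rightarrow> 0\<close> and \<open>x\<close> has constant
  variance.\<close>
lemma ip_X_eq_0:
  assumes h: "square_integrable M h" and orth: "\<And>s j. s < t \<Longrightarrow> j < n \<Longrightarrow> ip M (V s j) h = 0"
    and i: "i < n"
  shows "ip M (X t i) h = 0"
proof -
  have "(\<lambda>k. (A ^\<^sub>m k) $$ (i, j) * ip M (X (t - int k) j) h) \<longlonglongrightarrow> 0" if j: "j < n" for j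
  proof (rule Lim_null_comparison)
    let ?b = "sqrt (ip M (X 0 j) (X 0 j) * ip M h h)"
    show "(\<lambda>k. \<bar>(A ^\<^sub>m k) $$ (i, j)\<bar> * ?b) \<longlonglongrightarrow> 0"
      using asymptotically_stable_powers_tendsto_0[OF A_carrier A_stable i j]
      by (intro tendsto_mult_left_zero tendsto_rabs_zero)
    have "\<bar>ip M (X s j) h\<bar> \<le> ?b" for s
      using ip_Cauchy_Schwarz[OF L2(1)[OF j] h, of s] ip_X_stationary[OF j, of s]
      by (simp add: real_le_rsqrt)
    then show "\<forall>\<^sub>F k in sequentially. norm ((A ^\<^sub>m k) $$ (i, j) * ip M (X (t - int k) j) h)
        \<le> \<bar>(A ^\<^sub>m k) $$ (i, j)\<bar> * ?b"
      by (simp add: abs_mult mult_left_mono)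
  qed
  then have "(\<lambda>k. \<Sum>j<n. (A ^\<^sub>m k) $$ (i, j) * ip M (X (t - int k) j) h) \<longlonglongrightarrow> 0"
    by (intro tendsto_null_sum) auto
  moreover have "ip M (X t i) h = (\<Sum>j<n. (A ^\<^sub>m k) $$ (i, j) * ip M (X (t - int k) j) h)" for k
    by (rule ip_X_iterate[OF h _ i]) (rule orth)
  ultimately show ?thesis by (simp add: LIMSEQ_const_iff)
qed

section \<open>Orthogonality relations between state, noises and observations\<close>

lemma ip_V_V: "i < n \<Longrightarrow> j < n \<Longrightarrow> ip M (V s i) (V t j) = (if s = t then Q $$ (i, j) else 0)"
  using v_white unfolding ip_def V_def by simp

lemma ip_V_W: "i < n \<Longrightarrow> ip M (V s i) (W t k) = 0"
  using v_w_uncorrelated unfolding ip_def V_def W_def by simp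

lemma ip_W_W: "s \<noteq> t \<Longrightarrow> ip M (W s k) (W t l) = 0"
  using w_white unfolding ip_def W_def by simp

text \<open>Causality of the state: \<open>V s j\<close> with \<open>t \<le> s\<close> is orthogonal
  to all inputs before \<open>t\<close>, hence to the state that they generate. The relation with
  \<open>W\<close> below has the same source, there for all pairs of times.\<close>

lemma ip_X_V: "i < n \<Longrightarrow> j < n \<Longrightarrow> t \<le> s \<Longrightarrow> ip M (X t i) (V s j) = 0"
  by (rule ip_X_eq_0) (auto simp: ip_V_V)

lemma ip_X_W: "i < n \<Longrightarrow> ip M (X t i) (W s k) = 0"
  by (rule ip_X_eq_0) (auto simp: ip_V_W)

lemma ip_Y_V: "j < n \<Longrightarrow> t \<le> s \<Longrightarrow> ip M (Y t k) (V s j) = 0"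
  using ip_V_W by (simp add: ip_Y ip_X_V ip_commute[of M "W t k"])

lemma ip_Y_W: "s \<noteq> t \<Longrightarrow> ip M (Y t k) (W s l) = 0"
  by (simp add: ip_Y ip_X_W ip_W_W)

lemma observations_iff: "f \<in> observations y N r \<longleftrightarrow> (\<exists>s k. f = Y s k \<and> s \<le> r \<and> k < N)"
  unfolding observations_def Y_def by auto

lemma observations_L2: "f \<in> observations y N r \<Longrightarrow> square_integrable M f"
  by (auto simp: observations_iff)

text \<open>Equality of \<open>r\<close> and \<open>s\<close> is allowed, because
  \<open>v(s)\<close> first acts on \<open>x(s + 1)\<close>. In contrast \<open>w(s)\<close> already
  enters \<open>y(s)\<close>, which explains the strict inequality in
  \<open>ip_W_past\<close>.\<close>

lemma ip_V_past:
  assumes "g \<in> closed_linear_span M (observations y N r)" "r \<le> s" "j < n"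
  shows "ip M (V s j) g = 0"
  using assms
  by (intro closed_linear_span_orthogonal[OF assms(1)])
    (auto simp: observations_iff ip_Y_V ip_commute[of M "V s j"])

lemma ip_W_past:
  assumes "g \<in> closed_linear_span M (observations y N r)" "r < s"
  shows "ip M (W s k) g = 0"
  using assms
  by (intro closed_linear_span_orthogonal[OF assms(1)])
    (auto simp: observations_iff ip_Y_W ip_commute[of M "W s k"])

section \<open>The prediction error covariance is positive definite\<close>

text \<open>\<open>u \<bullet> x(t)\<close> is a mean-square limit of combinations of \<open>y\<^sub>N(s)\<close>, \<open>s < t\<close>.\<close>
definition predictable :: "nat \<Rightarrow> int \<Rightarrow> real vec \<Rightarrow> bool" where
  "predictable N t u \<longleftrightarrow> u \<in> carrier_vec n \<and>
     (\<forall>\<epsilon>>0. \<exists>g \<in> linear_combinations (observations y N (t - 1)).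
        ip M (\<lambda>\<omega>. (\<Sum>i<n. u $ i * X t i \<omega>) - g \<omega>) (\<lambda>\<omega>. (\<Sum>i<n. u $ i * X t i \<omega>) - g \<omega>) < \<epsilon>)"

text \<open>Observations form a set of functions in which different index pairs may give the same
  element. Induction on the combination therefore chooses indices term by term instead of
  partitioning the set by time.\<close>

lemma linear_combinations_observations_decompose:
  assumes "g \<in> linear_combinations (observations y N t)"
  shows "\<exists>c. \<exists>g' \<in> linear_combinations (observations y N (t - 1)).
    g = (\<lambda>\<omega>. (\<Sum>k<N. c k * Y t k \<omega>) + g' \<omega>)"
  using assms
proof (induction rule: linear_combinations_induct)
  case zero
  show ?case by (intro exI[of _ "\<lambda>_. 0"] bexI[OF _ linear_combinations_0]) simp
next
  case (step a f h)
  then obtain c g' where g': "g' \<in> linear_combinations (observations y N (t - 1))"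
    "h = (\<lambda>\<omega>. (\<Sum>k<N. c k * Y t k \<omega>) + g' \<omega>)" by blast
  from step(1) obtain s l where f: "f = Y s l" "s \<le> t" "l < N" by (auto simp: observations_iff)
  show ?case
  proof (cases "s = t")
    case True
    have "(\<Sum>k<N. (c k + (if k = l then a else 0)) * Y t k \<omega>) = (\<Sum>k<N. c k * Y t k \<omega>) + a * Y t l \<omega>" for \<omega>
      using f(3) by (simp add: distrib_right sum.distrib if_distrib[of "\<lambda>b. b * _"] cong: if_cong)
    then show ?thesis using g' f True
      by (intro exI[of _ "\<lambda>k. c k + (if k = l then a else 0)"] bexI[OF _ g'(1)]) (simp add: add_ac)
  next
    case False
    with f have "s \<le> t - 1" by simp
    with f have "f \<in> observations y N (t - 1)" unfolding observations_iff by blast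
    then have "(\<lambda>\<omega>. a * f \<omega> + g' \<omega>) \<in> linear_combinations (observations y N (t - 1))"
      by (intro linear_combinations_add[OF _ g'(1)] linear_combinations_cmult linear_combinations_superset)
    then show ?thesis unfolding g'(2)
      by (intro exI[of _ c] bexI[of _ "\<lambda>\<omega>. a * f \<omega> + g' \<omega>"]) (simp_all add: add_ac)
  qed
qed

lemma ip_orthogonal_triple:
  assumes "square_integrable M f" "square_integrable M g" "square_integrable M h"
    and "ip M g f = 0" "ip M h f = 0" "ip M g h = 0"
  shows "ip M (\<lambda>\<omega>. f \<omega> + g \<omega> - h \<omega>) (\<lambda>\<omega>. f \<omega> + g \<omega> - h \<omega>) = ip M f f + ip M g g + ip M h h"
  using assms by (simp add: ip_add_left ip_add_right ip_diff_left ip_diff_right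
      ip_commute[of M f g] ip_commute[of M f h] ip_commute[of M h g])

text \<open>Inserting both model equations at time \<open>t - 1\<close> writes the error as a part
  known from \<open>x(t - 1)\<close> and older observations, plus \<open>u . v(t - 1)\<close>, minus
  \<open>c . w(t - 1)\<close>. These three are mutually orthogonal, so a small error makes each of
  them small.\<close>

lemma prediction_error_decompose:
  assumes u: "u \<in> carrier_vec n" and g: "g \<in> linear_combinations (observations y N (t - 1))"
  obtains c g' where "g' \<in> linear_combinations (observations y N (t - 1 - 1))"
    "ip M (\<lambda>\<omega>. (\<Sum>i<n. u $ i * X t i \<omega>) - g \<omega>) (\<lambda>\<omega>. (\<Sum>i<n. u $ i * X t i \<omega>) - g \<omega>) =
     ip M (\<lambda>\<omega>. (\<Sum>i<n. (A\<^sup>T *\<^sub>v u) $ i * X (t - 1) i \<omega>) - g' \<omega> - (\<Sum>k<N. c k * (\<Sum>j<n. C k j * X (t - 1) j \<omega>)))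
       (\<lambda>\<omega>. (\<Sum>i<n. (A\<^sup>T *\<^sub>v u) $ i * X (t - 1) i \<omega>) - g' \<omega> - (\<Sum>k<N. c k * (\<Sum>j<n. C k j * X (t - 1) j \<omega>)))
     + ip M (\<lambda>\<omega>. \<Sum>i<n. u $ i * V (t - 1) i \<omega>) (\<lambda>\<omega>. \<Sum>i<n. u $ i * V (t - 1) i \<omega>)
     + ip M (\<lambda>\<omega>. \<Sum>k<N. c k * W (t - 1) k \<omega>) (\<lambda>\<omega>. \<Sum>k<N. c k * W (t - 1) k \<omega>)"
proof -
  obtain c g' where g': "g' \<in> linear_combinations (observations y N (t - 1 - 1))"
    and gdec: "g = (\<lambda>\<omega>. (\<Sum>k<N. c k * Y (t - 1) k \<omega>) + g' \<omega>)"
    using linear_combinations_observations_decompose[OF g] by blast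
  have gL: "square_integrable M g" by (rule linear_combinations_square_integrable[OF g observations_L2])
  have gL': "square_integrable M g'" by (rule linear_combinations_square_integrable[OF g' observations_L2])
  have gC': "g' \<in> closed_linear_span M (observations y N (t - 1 - 1))"
    by (rule linear_combinations_closed_linear_span[OF g' observations_L2])
  define f1 where "f1 = (\<lambda>\<omega>. \<Sum>i<n. (A\<^sup>T *\<^sub>v u) $ i * X (t - 1) i \<omega>)"
  define f2 where "f2 = (\<lambda>\<omega>. \<Sum>k<N. c k * (\<Sum>j<n. C k j * X (t - 1) j \<omega>))"
  define f where "f = (\<lambda>\<omega>. f1 \<omega> - g' \<omega> - f2 \<omega>)"
  define vu where "vu = (\<lambda>\<omega>. \<Sum>i<n. u $ i * V (t - 1) i \<omega>)"
  define wc where "wc = (\<lambda>\<omega>. \<Sum>k<N. c k * W (t - 1) k \<omega>)"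
  have L: "square_integrable M f1" "square_integrable M f2" "square_integrable M f"
    "square_integrable M vu" "square_integrable M wc"
    using gL' by (simp_all add: f1_def f2_def f_def vu_def wc_def)
  have inner: "square_integrable M (\<lambda>\<omega>. \<Sum>j<n. C k j * X (t - 1) j \<omega>)" for k by simp
  have V0: "ip M (V (t - 1) i) f = 0" if "i < n" for i
  proof -
    have "ip M (V (t - 1) i) f1 = 0" unfolding f1_def using that
      by (simp add: ip_sum_cmult_left ip_commute[of M "V (t - 1) i"] ip_X_V)
    moreover have "ip M (V (t - 1) i) f2 = 0" unfolding f2_def using that inner
      by (simp add: ip_sum_cmult_left ip_commute[of M "V (t - 1) i"] ip_X_V)
    moreover have "ip M (V (t - 1) i) g' = 0" by (rule ip_V_past[OF gC' _ that]) simp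
    ultimately show ?thesis unfolding f_def using L gL' that by (simp add: ip_diff_right)
  qed
  have W0: "ip M (W (t - 1) k) f = 0" for k
  proof -
    have "ip M (W (t - 1) k) f1 = 0" unfolding f1_def
      by (simp add: ip_sum_cmult_left ip_commute[of M "W (t - 1) k"] ip_X_W)
    moreover have "ip M (W (t - 1) k) f2 = 0" unfolding f2_def using inner
      by (simp add: ip_sum_cmult_left ip_commute[of M "W (t - 1) k"] ip_X_W)
    moreover have "ip M (W (t - 1) k) g' = 0" by (rule ip_W_past[OF gC']) simp
    ultimately show ?thesis unfolding f_def using L gL' by (simp add: ip_diff_right)
  qed
  have "ip M vu f = 0" unfolding vu_def using V0 L by (simp add: ip_sum_cmult_left)
  moreover have "ip M wc f = 0" unfolding wc_def using W0 L by (simp add: ip_sum_cmult_left)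
  moreover have "ip M vu wc = 0"
    unfolding vu_def using L(5) by (simp add: ip_sum_cmult_left)
      (simp add: wc_def ip_sum_cmult_right ip_V_W)
  ultimately have *: "ip M (\<lambda>\<omega>. f \<omega> + vu \<omega> - wc \<omega>) (\<lambda>\<omega>. f \<omega> + vu \<omega> - wc \<omega>) = ip M f f + ip M vu vu + ip M wc wc"
    using L by (intro ip_orthogonal_triple)
  have XAE: "AE \<omega> in M. \<forall>i<n. X t i \<omega> = (\<Sum>j<n. A $$ (i, j) * X (t - 1) j \<omega>) + V (t - 1) i \<omega>"
    using state_AE[of _ "t - 1"] by (intro AE_all_less) simp
  have YAE: "AE \<omega> in M. \<forall>k<N. Y (t - 1) k \<omega> = (\<Sum>j<n. C k j * X (t - 1) j \<omega>) + W (t - 1) k \<omega>"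
    by (intro AE_all_less output_AE)
  have AE: "AE \<omega> in M. (\<Sum>i<n. u $ i * X t i \<omega>) - g \<omega> = f \<omega> + vu \<omega> - wc \<omega>"
    using XAE YAE
  proof eventually_elim
    case (elim \<omega>)
    have "(\<Sum>i<n. u $ i * X t i \<omega>) = (\<Sum>i<n. \<Sum>j<n. u $ i * A $$ (i, j) * X (t - 1) j \<omega>) + vu \<omega>"
      using elim(1) by (simp add: vu_def distrib_left sum.distrib sum_distrib_left mult.assoc)
    also have "(\<Sum>i<n. \<Sum>j<n. u $ i * A $$ (i, j) * X (t - 1) j \<omega>) =
        (\<Sum>j<n. \<Sum>i<n. u $ i * A $$ (i, j) * X (t - 1) j \<omega>)"
      by (rule sum.swap)
    also have "\<dots> = f1 \<omega>" unfolding f1_def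
      using A_carrier u
      by (intro sum.cong refl) (simp add: scalar_prod_def atLeast0LessThan sum_distrib_left
          mult_ac)
    finally have "(\<Sum>i<n. u $ i * X t i \<omega>) = f1 \<omega> + vu \<omega>" .
    moreover have "g \<omega> = f2 \<omega> + wc \<omega> + g' \<omega>"
      using elim(2) by (simp add: gdec f2_def wc_def distrib_left sum.distrib)
    ultimately show ?case by (simp add: f_def)
  qed
  have "ip M (\<lambda>\<omega>. (\<Sum>i<n. u $ i * X t i \<omega>) - g \<omega>) (\<lambda>\<omega>. (\<Sum>i<n. u $ i * X t i \<omega>) - g \<omega>) =
     ip M (\<lambda>\<omega>. f \<omega> + vu \<omega> - wc \<omega>) (\<lambda>\<omega>. f \<omega> + vu \<omega> - wc \<omega>)"
    by (rule ip_cong_AE[OF AE AE]) (use L gL in simp_all)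
  then show thesis
    using that[OF g', of c] * unfolding f_def f1_def f2_def vu_def wc_def by simp
qed


lemma Q_symmetric: "Q\<^sup>T = Q"
proof (rule eq_matI)
  fix i j assume "i < dim_row Q" "j < dim_col Q"
  then have ij: "i < n" "j < n" using Q_carrier by auto
  have "Q $$ (j, i) = Q $$ (i, j)"
    using ip_V_V[OF ij, of 0 0] ip_V_V[OF ij(2,1), of 0 0] ip_commute[of M "V 0 i" "V 0 j"] by simp
  then show "Q\<^sup>T $$ (i, j) = Q $$ (i, j)" using ij Q_carrier by simp
qed (use Q_carrier in auto)

abbreviation noise_cov :: "nat \<Rightarrow> int \<Rightarrow> real mat" where
  "noise_cov N t \<equiv> cov_mat M N (\<lambda>\<omega>. vec N (w t \<omega>))"

lemma noise_cov_eq: "noise_cov N t = mat N N (\<lambda>(k, l). ip M (W t k) (W t l))"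
  unfolding cov_mat_def by (intro eq_matI) (auto simp: ip_def W_def)

text \<open>The \<open>v\<close> term of the decomposed error does not depend on the approximant, so
  it is exactly 0. The \<open>w\<close> term bounds the coefficients \<open>c\<close> through
  \<open>R_N > 0\<close>; with \<open>c\<close> small, the contribution of \<open>c\<close> to the
  state part is negligible and \<open>g'\<close> alone approximates at time
  \<open>t - 1\<close>.\<close>

lemma predictable_step:
  assumes N: "N \<ge> 1" and pred: "predictable N t u"
  shows "Q *\<^sub>v u = 0\<^sub>v n" "predictable N (t - 1) (A\<^sup>T *\<^sub>v u)"
proof -
  have u: "u \<in> carrier_vec n" using pred by (simp add: predictable_def)
  have Au: "A\<^sup>T *\<^sub>v u \<in> carrier_vec n" using A_carrier u by simp
  let ?Xu = "\<lambda>\<omega>. \<Sum>i<n. u $ i * X t i \<omega>"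
  let ?vu = "\<lambda>\<omega>. \<Sum>i<n. u $ i * V (t - 1) i \<omega>"
  let ?Z = "\<lambda>k \<omega>. \<Sum>j<n. C k j * X (t - 1) j \<omega>"
  let ?f = "\<lambda>\<omega>. \<Sum>i<n. (A\<^sup>T *\<^sub>v u) $ i * X (t - 1) i \<omega>"
  have err: "\<exists>c. \<exists>g' \<in> linear_combinations (observations y N (t - 1 - 1)).
      ip M (\<lambda>\<omega>. ?f \<omega> - g' \<omega> - (\<Sum>k<N. c k * ?Z k \<omega>)) (\<lambda>\<omega>. ?f \<omega> - g' \<omega> - (\<Sum>k<N. c k * ?Z k \<omega>))
      + ip M ?vu ?vu + ip M (\<lambda>\<omega>. \<Sum>k<N. c k * W (t - 1) k \<omega>) (\<lambda>\<omega>. \<Sum>k<N. c k * W (t - 1) k \<omega>) < \<epsilon>"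
    if \<epsilon>: "\<epsilon> > 0" for \<epsilon>
  proof -
    obtain g where g: "g \<in> linear_combinations (observations y N (t - 1))"
      "ip M (\<lambda>\<omega>. ?Xu \<omega> - g \<omega>) (\<lambda>\<omega>. ?Xu \<omega> - g \<omega>) < \<epsilon>"
      using conjunct2[OF pred[unfolded predictable_def], rule_format, OF \<epsilon>] by blast
    obtain c g' where g': "g' \<in> linear_combinations (observations y N (t - 1 - 1))"
      "ip M (\<lambda>\<omega>. ?Xu \<omega> - g \<omega>) (\<lambda>\<omega>. ?Xu \<omega> - g \<omega>) =
       ip M (\<lambda>\<omega>. ?f \<omega> - g' \<omega> - (\<Sum>k<N. c k * ?Z k \<omega>)) (\<lambda>\<omega>. ?f \<omega> - g' \<omega> - (\<Sum>k<N. c k * ?Z k \<omega>))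
       + ip M ?vu ?vu + ip M (\<lambda>\<omega>. \<Sum>k<N. c k * W (t - 1) k \<omega>) (\<lambda>\<omega>. \<Sum>k<N. c k * W (t - 1) k \<omega>)"
      by (rule prediction_error_decompose[OF u g(1)])
    show ?thesis
      using g(2) unfolding g'(2) by (intro exI[of _ c] bexI[OF _ g'(1)])
  qed
  have "ip M ?vu ?vu \<le> \<epsilon>" if \<epsilon>: "\<epsilon> > 0" for \<epsilon>
  proof -
    obtain c g' where "ip M (\<lambda>\<omega>. ?f \<omega> - g' \<omega> - (\<Sum>k<N. c k * ?Z k \<omega>)) (\<lambda>\<omega>. ?f \<omega> - g' \<omega> - (\<Sum>k<N. c k * ?Z k \<omega>))
      + ip M ?vu ?vu + ip M (\<lambda>\<omega>. \<Sum>k<N. c k * W (t - 1) k \<omega>) (\<lambda>\<omega>. \<Sum>k<N. c k * W (t - 1) k \<omega>) < \<epsilon>"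
      using err[OF \<epsilon>] by blast
    moreover have "0 \<le> ip M (\<lambda>\<omega>. ?f \<omega> - g' \<omega> - (\<Sum>k<N. c k * ?Z k \<omega>)) (\<lambda>\<omega>. ?f \<omega> - g' \<omega> - (\<Sum>k<N. c k * ?Z k \<omega>))"
      "0 \<le> ip M (\<lambda>\<omega>. \<Sum>k<N. c k * W (t - 1) k \<omega>) (\<lambda>\<omega>. \<Sum>k<N. c k * W (t - 1) k \<omega>)"
      by (rule ip_self_nonneg)+
    ultimately show ?thesis by linarith
  qed
  then have "ip M ?vu ?vu \<le> 0" by (rule field_le_epsilon[of _ 0, simplified])
  then have vu0: "ip M ?vu ?vu = 0" by (intro antisym ip_self_nonneg)
  show "Q *\<^sub>v u = 0\<^sub>v n"
  proof (rule eq_vecI)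
    fix i assume "i < dim_vec (0\<^sub>v n :: real vec)"
    then have i: "i < n" by simp
    have vuL: "square_integrable M ?vu" by simp
    \<comment> \<open>The \<open>i\<close>-th entry of \<open>Q u\<close> is the covariance of
      \<open>v_i\<close> with \<open>u . v\<close>, which vanishes because the latter has second
      moment 0.\<close>
    have "(ip M (V (t - 1) i) ?vu)\<^sup>2 \<le> 0"
      using ip_Cauchy_Schwarz[OF L2(2)[OF i] vuL, of "t - 1"] unfolding vu0 by simp
    then have "ip M (V (t - 1) i) ?vu = 0" by simp
    moreover have "ip M (V (t - 1) i) ?vu = (\<Sum>j<n. u $ j * Q $$ (i, j))"
      using i by (simp add: ip_sum_cmult_right ip_V_V)
    ultimately show "(Q *\<^sub>v u) $ i = 0\<^sub>v n $ i"
      using i u Q_carrier by (simp add: scalar_prod_def atLeast0LessThan mult.commute)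
  qed (use Q_carrier in simp)
  obtain r where r: "0 < r"
    "\<And>c. c \<in> carrier_vec N \<Longrightarrow> r * (c \<bullet> c) \<le> c \<bullet> (noise_cov N (t - 1) *\<^sub>v c)"
    using positive_definite_lower_bound[OF noise_cov_pos[OF N, of "t - 1"]] by blast
  have rW: "r * (\<Sum>k<N. (c k)\<^sup>2) \<le> ip M (\<lambda>\<omega>. \<Sum>k<N. c k * W (t - 1) k \<omega>) (\<lambda>\<omega>. \<Sum>k<N. c k * W (t - 1) k \<omega>)" for c
  proof -
    have "vec N c \<in> carrier_vec N" by simp
    from r(2)[OF this] scalar_prod_gram[of N M "W (t - 1)", OF L2(4) this this]
    show ?thesis by (simp add: noise_cov_eq scalar_prod_def atLeast0LessThan power2_eq_square)
  qed
  \<comment> \<open>The total second moment of the noise-free outputs at time \<open>t - 1\<close>: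
    the factor by which the squared length of \<open>c\<close> is multiplied when the
    \<open>c\<close> term is moved out of the error.\<close>
  define B where "B = (\<Sum>k<N. ip M (?Z k) (?Z k))"
  have B: "0 \<le> B" unfolding B_def by (intro sum_nonneg ip_self_nonneg)
  have ZL: "square_integrable M (?Z k)" for k by simp
  show "predictable N (t - 1) (A\<^sup>T *\<^sub>v u)"
    unfolding predictable_def
  proof (intro conjI allI impI Au)
    fix \<epsilon> :: real assume \<epsilon>: "\<epsilon> > 0"
    \<comment> \<open>Chosen so that the final bound
      \<open>2 * \<delta> + 2 * (\<delta> / r * B)\<close> equals \<open>\<epsilon>\<close>; the
      factors 2 come from \<open>ip_add_self_le\<close>.\<close>
    define \<delta> where "\<delta> = \<epsilon> / (2 * (1 + B / r))"
    have \<delta>: "\<delta> > 0" unfolding \<delta>_def using \<epsilon> B r(1) by (simp add: add_pos_nonneg)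
    obtain c g' where g': "g' \<in> linear_combinations (observations y N (t - 1 - 1))" and
      small: "ip M (\<lambda>\<omega>. ?f \<omega> - g' \<omega> - (\<Sum>k<N. c k * ?Z k \<omega>)) (\<lambda>\<omega>. ?f \<omega> - g' \<omega> - (\<Sum>k<N. c k * ?Z k \<omega>))
      + ip M ?vu ?vu + ip M (\<lambda>\<omega>. \<Sum>k<N. c k * W (t - 1) k \<omega>) (\<lambda>\<omega>. \<Sum>k<N. c k * W (t - 1) k \<omega>) < \<delta>"
      using err[OF \<delta>] by blast
    define z where "z = (\<lambda>\<omega>. \<Sum>k<N. c k * ?Z k \<omega>)"
    define h where "h = (\<lambda>\<omega>. ?f \<omega> - g' \<omega> - z \<omega>)"
    have gL': "square_integrable M g'"
      by (rule linear_combinations_square_integrable[OF g' observations_L2])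
    have zL: "square_integrable M z" unfolding z_def by simp
    have hL: "square_integrable M h" unfolding h_def using gL' zL by simp
    have hs: "ip M h h + ip M (\<lambda>\<omega>. \<Sum>k<N. c k * W (t - 1) k \<omega>) (\<lambda>\<omega>. \<Sum>k<N. c k * W (t - 1) k \<omega>) < \<delta>"
      using small unfolding vu0 h_def z_def by simp
    then have h: "ip M h h < \<delta>" and "r * (\<Sum>k<N. (c k)\<^sup>2) < \<delta>"
      using rW[of c] ip_self_nonneg[of M h]
        ip_self_nonneg[of M "\<lambda>\<omega>. \<Sum>k<N. c k * W (t - 1) k \<omega>"] by linarith+
    then have "(\<Sum>k<N. (c k)\<^sup>2) \<le> \<delta> / r" using r(1) by (simp add: field_simps)
    then have "(\<Sum>k<N. (c k)\<^sup>2) * B \<le> \<delta> / r * B" by (rule mult_right_mono[OF _ B])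
    moreover have "ip M z z \<le> (\<Sum>k<N. (c k)\<^sup>2) * B"
      unfolding z_def B_def by (rule ip_sum_self_le[OF ZL])
    ultimately have "ip M z z \<le> \<delta> / r * B" by linarith
    moreover have "ip M (\<lambda>\<omega>. h \<omega> + z \<omega>) (\<lambda>\<omega>. h \<omega> + z \<omega>) \<le> 2 * ip M h h + 2 * ip M z z"
      by (rule ip_add_self_le[OF hL zL])
    ultimately have "ip M (\<lambda>\<omega>. h \<omega> + z \<omega>) (\<lambda>\<omega>. h \<omega> + z \<omega>) < 2 * \<delta> + 2 * (\<delta> / r * B)"
      using h by linarith
    also have "\<dots> = \<delta> * (2 * (1 + B / r))" by (simp add: algebra_simps)
    also have "\<dots> = \<epsilon>"
    proof -
      have "2 * (1 + B / r) > 0" using B r(1) by (simp add: add_pos_nonneg)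
      then show ?thesis unfolding \<delta>_def by simp
    qed
    finally show "\<exists>g \<in> linear_combinations (observations y N (t - 1 - 1)).
        ip M (\<lambda>\<omega>. ?f \<omega> - g \<omega>) (\<lambda>\<omega>. ?f \<omega> - g \<omega>) < \<epsilon>"
      using g' by (intro bexI[of _ g']) (simp_all add: h_def)
  qed
qed

text \<open>Reachability is applied to \<open>u\<close> itself, so orthogonality to the end point
  gives \<open>u \<bullet> u = 0\<close>. The induction along the trajectory ranges over all times
  and all predictable vectors, because moving \<open>A\<close> to the other side replaces
  \<open>p\<close> by its image under the transpose of \<open>A\<close>, predictable one step
  earlier.\<close>

lemma predictable_eq_0:
  assumes N: "N \<ge> 1" and pred: "predictable N t u"
  shows "u = 0\<^sub>v n"
proof -
  have u: "u \<in> carrier_vec n" using pred by (simp add: predictable_def)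
  obtain T b z where b: "\<And>k. b k \<in> carrier_vec n" and z0: "z 0 = 0\<^sub>v n"
    and z: "\<And>k. k < T \<Longrightarrow> z (Suc k) = A *\<^sub>v z k + Q *\<^sub>v b k" and zT: "z (T :: nat) = u"
    using A_Q_reachable u Q_carrier unfolding reachable_def by fastforce
  have "z k \<in> carrier_vec n \<and> (\<forall>s u. predictable N s u \<longrightarrow> u \<bullet> z k = 0)" if "k \<le> T" for k
    using that
  proof (induction k)
    case 0
    then show ?case by (auto simp: z0 predictable_def)
  next
    case (Suc k)
    then have zk: "z k \<in> carrier_vec n" and IH: "\<And>s u. predictable N s u \<Longrightarrow> u \<bullet> z k = 0" by auto
    have Az: "A *\<^sub>v z k \<in> carrier_vec n" and Qb: "Q *\<^sub>v b k \<in> carrier_vec n"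
      using A_carrier Q_carrier zk b by auto
    have eq: "z (Suc k) = A *\<^sub>v z k + Q *\<^sub>v b k" using z Suc(2) by simp
    have "p \<bullet> z (Suc k) = 0" if p: "predictable N s p" for s p
    proof -
      have pc: "p \<in> carrier_vec n" using p by (simp add: predictable_def)
      have "p \<bullet> (A *\<^sub>v z k) = (A\<^sup>T *\<^sub>v p) \<bullet> z k"
        using transpose_vec_mult_scalar[OF A_carrier zk pc] by simp
      also have "\<dots> = 0" by (rule IH[OF predictable_step(2)[OF N p]])
      finally have "p \<bullet> (A *\<^sub>v z k) = 0" .
      moreover have "p \<bullet> (Q *\<^sub>v b k) = 0"
        using symmetric_scalar_prod[OF Q_carrier Q_symmetric pc b] predictable_step(1)[OF N p] b[of k]
        by (simp add: scalar_prod_right_zero[of _ n])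
      ultimately show ?thesis unfolding eq scalar_prod_add_distrib[OF pc Az Qb] by simp
    qed
    then show ?case unfolding eq using Az Qb by auto
  qed
  then have "u \<bullet> u = 0" using pred zT by blast
  then show ?thesis using scalar_prod_self_pos[OF u] by fastforce
qed

lemma error_cov_eq:
  assumes "\<And>\<omega>. z \<omega> \<in> carrier_vec n"
  shows "cov_mat M n (\<lambda>\<omega>. x t \<omega> - z \<omega>) =
    mat n n (\<lambda>(i, j). ip M (\<lambda>\<omega>. X t i \<omega> - z \<omega> $ i) (\<lambda>\<omega>. X t j \<omega> - z \<omega> $ j))"
proof -
  have "(x t \<omega> - z \<omega>) $ i = X t i \<omega> - z \<omega> $ i" if "i < n" for \<omega> i
    using carrier_vecD[OF assms[of \<omega>]] that by (simp add: X_def)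
  then show ?thesis unfolding cov_mat_def by (intro eq_matI) (auto simp: ip_def)
qed

text \<open>If the form vanishes at \<open>u\<close>, then \<open>u . x(t)\<close> is at mean-square
  distance 0 from its predictor, a limit of combinations of past observations. So \<open>u\<close>
  is predictable and hence zero.\<close>

lemma pred_cov_positive_definite:
  assumes N: "N \<ge> 1" and est: "kalman_estimate M n x y N t (t - 1) xp"
  shows "positive_definite n (cov_mat M n (\<lambda>\<omega>. x t \<omega> - xp \<omega>))"
proof -
  define e where "e i = (\<lambda>\<omega>. X t i \<omega> - xp \<omega> $ i)" for i
  have xp: "xp \<omega> \<in> carrier_vec n" for \<omega> using est by (simp add: kalman_estimate_def)
  have best: "(\<lambda>\<omega>. xp \<omega> $ i) \<in> closed_linear_span M (observations y N (t - 1))" if "i < n" for i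
    using est that by (auto simp: kalman_estimate_def best_linear_estimate_def)
  have xpL: "square_integrable M (\<lambda>\<omega>. xp \<omega> $ i)" if "i < n" for i
    by (rule closed_linear_span_square_integrable[OF best[OF that]])
  have eL: "square_integrable M (e i)" if "i < n" for i
    unfolding e_def using that xpL by simp
  have cov: "cov_mat M n (\<lambda>\<omega>. x t \<omega> - xp \<omega>) = mat n n (\<lambda>(i, j). ip M (e i) (e j))" (is "?P = _")
    unfolding e_def by (rule error_cov_eq[OF xp])
  show ?thesis unfolding positive_definite_def
  proof (intro conjI ballI impI)
    show "?P \<in> carrier_mat n n" by (simp add: cov_mat_def)
    show "?P\<^sup>T = ?P" unfolding cov by (intro eq_matI) (auto simp: ip_commute)
    fix u :: "real vec" assume u: "u \<in> carrier_vec n" "u \<noteq> 0\<^sub>v n"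
    let ?Xu = "\<lambda>\<omega>. \<Sum>i<n. u $ i * X t i \<omega>" and ?p = "\<lambda>\<omega>. \<Sum>i<n. u $ i * xp \<omega> $ i"
    have "u \<bullet> (?P *\<^sub>v u) = ip M (\<lambda>\<omega>. \<Sum>i<n. u $ i * e i \<omega>) (\<lambda>\<omega>. \<Sum>i<n. u $ i * e i \<omega>)"
      unfolding cov by (rule scalar_prod_gram[OF eL u(1) u(1)])
    also have "(\<lambda>\<omega>. \<Sum>i<n. u $ i * e i \<omega>) = (\<lambda>\<omega>. ?Xu \<omega> - ?p \<omega>)"
      by (simp add: e_def right_diff_distrib sum_subtractf)
    finally have eq: "u \<bullet> (?P *\<^sub>v u) = ip M (\<lambda>\<omega>. ?Xu \<omega> - ?p \<omega>) (\<lambda>\<omega>. ?Xu \<omega> - ?p \<omega>)" .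
    show "0 < u \<bullet> (?P *\<^sub>v u)"
    proof (rule ccontr)
      assume "\<not> 0 < u \<bullet> (?P *\<^sub>v u)"
      then have 0: "ip M (\<lambda>\<omega>. ?Xu \<omega> - ?p \<omega>) (\<lambda>\<omega>. ?Xu \<omega> - ?p \<omega>) = 0"
        unfolding eq by (intro antisym ip_self_nonneg) simp
      have "?p \<in> closed_linear_span M (observations y N (t - 1))"
        by (intro closed_linear_span_sum closed_linear_span_cmult observations_L2 best) simp_all
      then obtain G where G: "\<And>m. G m \<in> linear_combinations (observations y N (t - 1))"
        and Gp: "mean_square_limit M G ?p" unfolding closed_linear_span_def by blast
      note lim = Gp[unfolded mean_square_limit_ip]
      have "predictable N t u" unfolding predictable_def
      proof (intro conjI allI impI u)
        fix \<epsilon> :: real assume "\<epsilon> > 0"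
        \<comment> \<open>Half of \<open>\<epsilon>\<close> compensates the factor 2 in
          \<open>ip_add_self_le\<close>; the other summand there is 0.\<close>
        then have "\<forall>\<^sub>F m in sequentially. ip M (\<lambda>\<omega>. G m \<omega> - ?p \<omega>) (\<lambda>\<omega>. G m \<omega> - ?p \<omega>) < \<epsilon> / 2"
          using lim by (intro order_tendstoD(2)[of _ 0]) auto
        then obtain m where m: "ip M (\<lambda>\<omega>. G m \<omega> - ?p \<omega>) (\<lambda>\<omega>. G m \<omega> - ?p \<omega>) < \<epsilon> / 2"
          using eventually_happens by force
        define d where "d = (\<lambda>\<omega>. G m \<omega> - ?p \<omega>)"
        define e' where "e' = (\<lambda>\<omega>. ?Xu \<omega> - ?p \<omega>)"
        have L: "square_integrable M d" "square_integrable M e'"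
          using lim xpL unfolding d_def e'_def by simp_all
        have "ip M (\<lambda>\<omega>. e' \<omega> + (- 1) * d \<omega>) (\<lambda>\<omega>. e' \<omega> + (- 1) * d \<omega>)
            \<le> 2 * ip M e' e' + 2 * ip M (\<lambda>\<omega>. (- 1) * d \<omega>) (\<lambda>\<omega>. (- 1) * d \<omega>)"
          by (rule ip_add_self_le[OF L(2) square_integrable_cmult[OF L(1)]])
        also have "ip M (\<lambda>\<omega>. (- 1) * d \<omega>) (\<lambda>\<omega>. (- 1) * d \<omega>) = ip M d d"
          by (simp add: ip_def)
        also have "ip M e' e' = 0" using 0 by (simp add: e'_def)
        also have "2 * 0 + 2 * ip M d d < \<epsilon>" using m by (simp add: d_def)
        also have "(\<lambda>\<omega>. e' \<omega> + (- 1) * d \<omega>) = (\<lambda>\<omega>. ?Xu \<omega> - G m \<omega>)"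
          by (simp add: d_def e'_def)
        finally show "\<exists>g \<in> linear_combinations (observations y N (t - 1)).
            ip M (\<lambda>\<omega>. ?Xu \<omega> - g \<omega>) (\<lambda>\<omega>. ?Xu \<omega> - g \<omega>) < \<epsilon>"
          using G by blast
      qed
      with u(2) predictable_eq_0[OF N] show False by blast
    qed
  qed
qed


section \<open>The filtering error covariance\<close>

text \<open>The estimate \<open>x\<^sup>* = x_pred + K (y - C x_pred)\<close> with \<open>K = \<Pi> C\<^sup>T R\<inverse>\<close> has an error orthogonal to all
  observations up to \<open>t\<close>, whose covariance with \<open>x\<close> is \<open>\<Pi>\<close>; so it may replace the filter.\<close>
lemma filter_cov_eq:
  assumes N: "N \<ge> 1" and pred: "kalman_estimate M n x y N t (t - 1) xp"
    and filt: "kalman_estimate M n x y N t t xf"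
  defines "P \<equiv> cov_mat M n (\<lambda>\<omega>. x t \<omega> - xp \<omega>)" and "Cm \<equiv> first_rows N n C"
  shows "cov_mat M n (\<lambda>\<omega>. x t \<omega> - xf \<omega>) = inv_mat (inv_mat P + Cm\<^sup>T * inv_mat (noise_cov N t) * Cm)"
proof -
  define R where "R = noise_cov N t"
  define S where "S = inv_mat P + Cm\<^sup>T * inv_mat R * Cm"
  define Pf where "Pf = inv_mat S"
  have PD_P: "positive_definite n P" unfolding P_def by (rule pred_cov_positive_definite[OF N pred])
  have PD_R: "positive_definite N R" unfolding R_def by (rule noise_cov_pos[OF N])
  have Cm: "Cm \<in> carrier_mat N n" by (simp add: Cm_def first_rows_def)
  have CmT: "Cm\<^sup>T \<in> carrier_mat n N" using Cm by simp
  note P = positive_definite_carrier[OF PD_P] and R = positive_definite_carrier[OF PD_R]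
  note Pi = positive_definite_inverse[OF PD_P] and Ri = positive_definite_inverse[OF PD_R]
  have PD_S: "positive_definite n S"
    unfolding S_def by (rule positive_definite_add_congruence[OF Pi(4) Ri(4) Cm])
  note S = positive_definite_carrier[OF PD_S] and Pf = positive_definite_inverse[OF PD_S, folded Pf_def]
  define G where "G = Pf * inv_mat P"
  define K where "K = Pf * (Cm\<^sup>T * inv_mat R)"
  have G: "G \<in> carrier_mat n n" using Pf Pi by (simp add: G_def)
  have K: "K \<in> carrier_mat n N" using Pf Ri Cm by (simp add: K_def)
  have CR: "Cm\<^sup>T * inv_mat R \<in> carrier_mat n N" using CmT Ri by simp
  \<comment> \<open>\<open>G + K C\<close> is \<open>Pf\<close> times the matrix that
    \<open>Pf\<close> inverts. This makes the updated error equal to \<open>G\<close> times the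
    prediction error minus \<open>K\<close> times the noise, without any further state term.\<close>
  have GKC: "G + K * Cm = 1\<^sub>m n"
  proof -
    have "K * Cm = Pf * (Cm\<^sup>T * inv_mat R * Cm)"
      unfolding K_def by (rule assoc_mult_mat[OF Pf(1) CR Cm])
    then have "G + K * Cm = Pf * S"
      unfolding G_def S_def using mult_add_distrib_mat[OF Pf(1) Pi(1) mult_carrier_mat[OF CR Cm]] by simp
    then show ?thesis using Pf(3) by simp
  qed
  \<comment> \<open>This and \<open>KR\<close> below give \<open>G P C^T = K R\<close>, the balance
    that makes the updated error orthogonal to \<open>y(t)\<close>.\<close>
  have GP: "G * P = Pf"
    unfolding G_def using assoc_mult_mat[OF Pf(1) Pi(1) P] Pi(3) Pf(1) by simp
  have KR: "K * R = Pf * Cm\<^sup>T"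
  proof -
    have "K * R = Pf * (Cm\<^sup>T * inv_mat R * R)"
      unfolding K_def by (rule assoc_mult_mat[OF Pf(1) CR R])
    also have "Cm\<^sup>T * inv_mat R * R = Cm\<^sup>T" using assoc_mult_mat[OF CmT Ri(1) R] Ri(3) CmT by simp
    finally show ?thesis .
  qed

  have xp: "xp \<omega> \<in> carrier_vec n" and xf: "xf \<omega> \<in> carrier_vec n" for \<omega>
    using pred filt by (simp_all add: kalman_estimate_def)
  have best_p: "best_linear_estimate M (observations y N (t - 1)) (X t i) (\<lambda>\<omega>. xp \<omega> $ i)"
    and best_f: "best_linear_estimate M (observations y N t) (X t i) (\<lambda>\<omega>. xf \<omega> $ i)" if "i < n" for i
    using pred filt that by (simp_all add: kalman_estimate_def X_def)
  have span_p: "(\<lambda>\<omega>. xp \<omega> $ i) \<in> closed_linear_span M (observations y N (t - 1))"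
    and span_f: "(\<lambda>\<omega>. xf \<omega> $ i) \<in> closed_linear_span M (observations y N t)" if "i < n" for i
    using best_p[OF that] best_f[OF that] by (simp_all add: best_linear_estimate_def)
  have "observations y N (t - 1) \<subseteq> observations y N t"
    unfolding observations_def by force
  then have span_mono: "f \<in> closed_linear_span M (observations y N t)"
    if "f \<in> closed_linear_span M (observations y N (t - 1))" for f
    using closed_linear_span_mono that by blast
  have xpL [simp]: "square_integrable M (\<lambda>\<omega>. xp \<omega> $ i)"
    and xfL [simp]: "square_integrable M (\<lambda>\<omega>. xf \<omega> $ i)" if "i < n" for i
    using closed_linear_span_square_integrable span_p[OF that] span_f[OF that] by blast+
  define e where "e i = (\<lambda>\<omega>. X t i \<omega> - xp \<omega> $ i)" for i
  define ef where "ef i = (\<lambda>\<omega>. X t i \<omega> - xf \<omega> $ i)" for i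
  have eL [simp]: "square_integrable M (e i)" and efL [simp]: "square_integrable M (ef i)"
    if "i < n" for i
    using that by (simp_all add: e_def ef_def)
  have e_orth: "ip M (e i) g = 0" if "i < n" "g \<in> closed_linear_span M (observations y N (t - 1))" for i g
    unfolding e_def by (rule best_linear_estimate_orthogonal[OF best_p[OF that(1)] _ that(2)]) (simp add: that)
  have ef_orth: "ip M (ef i) g = 0" if "i < n" "g \<in> closed_linear_span M (observations y N t)" for i g
    unfolding ef_def by (rule best_linear_estimate_orthogonal[OF best_f[OF that(1)] _ that(2)]) (simp add: that)
  have P_eq: "P $$ (i, j) = ip M (e i) (e j)" if "i < n" "j < n" for i j
    using that unfolding P_def e_def by (simp add: error_cov_eq[OF xp])
  have R_eq: "R $$ (k, l) = ip M (W t k) (W t l)" if "k < N" "l < N" for k l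
    using that unfolding R_def by (simp add: noise_cov_eq)
  \<comment> \<open>The prediction error is orthogonal to the predictor, so against it the state may
    be replaced by its own prediction error.\<close>
  have ip_e_X: "ip M (e i) (X t j) = P $$ (i, j)" if "i < n" "j < n" for i j
  proof -
    have "ip M (e i) (X t j) = ip M (e i) (\<lambda>\<omega>. e j \<omega> + xp \<omega> $ j)" by (simp add: e_def)
    also have "\<dots> = P $$ (i, j)"
      using that e_orth[OF that(1) span_p[OF that(2)]] by (simp add: ip_add_right P_eq)
    finally show ?thesis .
  qed
  have ip_W_e: "ip M (W t k) (e i) = 0" if "i < n" for i k
    unfolding e_def using that ip_W_past[OF span_p[OF that], of t k]
    by (simp add: ip_diff_right ip_commute[of M "W t k" "X t i"] ip_X_W)
  have ip_e_Y: "ip M (e i) (Y t k) = (P * Cm\<^sup>T) $$ (i, k)" if i: "i < n" and k: "k < N" for i k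
  proof -
    have "ip M (e i) (Y t k) = (\<Sum>j<n. C k j * ip M (e i) (X t j))"
      using i ip_W_e[OF i, of k] by (simp add: ip_commute[of M "e i"] ip_Y)
    also have "\<dots> = (\<Sum>j<n. P $$ (i, j) * Cm\<^sup>T $$ (j, k))"
      using i k by (intro sum.cong) (simp_all add: ip_e_X Cm_def first_rows_def)
    finally show ?thesis using index_mult_mat_sum[OF P CmT i k] by simp
  qed
  have ip_W_Y: "ip M (W t l) (Y t k) = R $$ (l, k)" if "l < N" "k < N" for l k
    using that by (simp add: ip_commute[of M "W t l" "Y t k"] ip_Y ip_X_W R_eq ip_commute[of M "W t k" "W t l"])

  \<comment> \<open>\<open>xs\<close> is the updated estimate and \<open>es'\<close> its actual
    error, while \<open>es\<close> is the closed form in prediction error and noise. They agree only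
    almost surely, since the output equation does.\<close>
  define es where "es i = (\<lambda>\<omega>. (\<Sum>l<n. G $$ (i, l) * e l \<omega>) - (\<Sum>k<N. K $$ (i, k) * W t k \<omega>))" for i
  define xs where "xs i = (\<lambda>\<omega>. xp \<omega> $ i + (\<Sum>k<N. K $$ (i, k) * (Y t k \<omega> - (\<Sum>j<n. C k j * xp \<omega> $ j))))" for i
  define es' where "es' i = (\<lambda>\<omega>. X t i \<omega> - xs i \<omega>)" for i
  have esL [simp]: "square_integrable M (es i)" for i unfolding es_def by simp
  have ip_es: "ip M (es i) h = (\<Sum>l<n. G $$ (i, l) * ip M (e l) h) - (\<Sum>k<N. K $$ (i, k) * ip M (W t k) h)"
    if "square_integrable M h" for i h
    unfolding es_def using that by (simp add: ip_diff_left ip_sum_cmult_left)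
  have span_xs: "xs i \<in> closed_linear_span M (observations y N t)" if "i < n" for i
    unfolding xs_def
  proof (intro closed_linear_span_add closed_linear_span_sum closed_linear_span_cmult closed_linear_span_diff)
    show "Y t k \<in> closed_linear_span M (observations y N t)" if "k \<in> {..<N}" for k
      using that by (intro linear_combinations_closed_linear_span linear_combinations_superset observations_L2)
        (auto simp: observations_iff)
  qed (use that in \<open>auto intro: span_mono span_p observations_L2\<close>)
  have xsL [simp]: "square_integrable M (xs i)" if "i < n" for i
    by (rule closed_linear_span_square_integrable[OF span_xs[OF that]])
  have esL' [simp]: "square_integrable M (es' i)" if "i < n" for i
    unfolding es'_def using that by simp
  have es_AE: "AE \<omega> in M. es' i \<omega> = es i \<omega>" if i: "i < n" for i
  proof -
    have "AE \<omega> in M. \<forall>k<N. Y t k \<omega> = (\<Sum>j<n. C k j * X t j \<omega>) + W t k \<omega>"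
      by (intro AE_all_less output_AE)
    then show ?thesis
    proof eventually_elim
      case (elim \<omega>)
      have "(\<Sum>k<N. K $$ (i, k) * (Y t k \<omega> - (\<Sum>j<n. C k j * xp \<omega> $ j))) =
          (\<Sum>k<N. K $$ (i, k) * (\<Sum>j<n. C k j * e j \<omega>)) + (\<Sum>k<N. K $$ (i, k) * W t k \<omega>)"
        unfolding sum.distrib[symmetric]
      proof (rule sum.cong)
        fix k assume "k \<in> {..<N}"
        then have "Y t k \<omega> - (\<Sum>j<n. C k j * xp \<omega> $ j) = (\<Sum>j<n. C k j * e j \<omega>) + W t k \<omega>"
          using elim by (simp add: e_def right_diff_distrib sum_subtractf)
        then show "K $$ (i, k) * (Y t k \<omega> - (\<Sum>j<n. C k j * xp \<omega> $ j)) =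
            K $$ (i, k) * (\<Sum>j<n. C k j * e j \<omega>) + K $$ (i, k) * W t k \<omega>"
          by (simp add: distrib_left)
      qed simp
      also have "(\<Sum>k<N. K $$ (i, k) * (\<Sum>j<n. C k j * e j \<omega>)) =
          (\<Sum>k<N. \<Sum>j<n. K $$ (i, k) * (C k j * e j \<omega>))"
        by (simp add: sum_distrib_left)
      also have "\<dots> = (\<Sum>j<n. \<Sum>k<N. K $$ (i, k) * (C k j * e j \<omega>))" by (rule sum.swap)
      also have "\<dots> = (\<Sum>j<n. (K * Cm) $$ (i, j) * e j \<omega>)"
        using index_mult_mat_sum[OF K Cm i]
        by (intro sum.cong) (simp_all add: Cm_def first_rows_def sum_distrib_right mult.assoc)
      finally have 1: "(\<Sum>k<N. K $$ (i, k) * (Y t k \<omega> - (\<Sum>j<n. C k j * xp \<omega> $ j))) =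
          (\<Sum>j<n. (K * Cm) $$ (i, j) * e j \<omega>) + (\<Sum>k<N. K $$ (i, k) * W t k \<omega>)" .
      have "(G + K * Cm) $$ (i, j) = G $$ (i, j) + (K * Cm) $$ (i, j)" if "j < n" for j
        using i that G K Cm by simp
      then have "(\<Sum>j<n. G $$ (i, j) * e j \<omega>) + (\<Sum>j<n. (K * Cm) $$ (i, j) * e j \<omega>)
          = (\<Sum>j<n. (G + K * Cm) $$ (i, j) * e j \<omega>)"
        unfolding sum.distrib[symmetric] by (intro sum.cong) (simp_all add: distrib_right)
      also have "\<dots> = (\<Sum>j<n. (if i = j then 1 else 0) * e j \<omega>)"
        unfolding GKC using i by (intro sum.cong) simp_all
      also have "\<dots> = e i \<omega>"
        using i by (simp add: if_distrib[of "\<lambda>c. c * _"] cong: if_cong)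
      finally have 2: "(\<Sum>j<n. G $$ (i, j) * e j \<omega>) + (\<Sum>j<n. (K * Cm) $$ (i, j) * e j \<omega>) = e i \<omega>" .
      have "es' i \<omega> = e i \<omega> - (\<Sum>k<N. K $$ (i, k) * (Y t k \<omega> - (\<Sum>j<n. C k j * xp \<omega> $ j)))"
        by (simp add: es'_def xs_def e_def)
      then show ?case using 1 2 by (simp add: es_def)
    qed
  qed
  have es'_orth: "ip M (es' i) g = 0" if i: "i < n" and g: "g \<in> closed_linear_span M (observations y N t)" for i g
  proof -
    have "ip M (es i) g = 0"
    proof (rule closed_linear_span_orthogonal[OF g esL observations_L2])
      fix f assume "f \<in> observations y N t"
      then obtain s k where f: "f = Y s k" "s \<le> t" "k < N" by (auto simp: observations_iff)
      show "ip M (es i) f = 0"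
      \<comment> \<open>Against \<open>y(t)\<close> the pairing is an entry of
        \<open>G P C^T - K R\<close>, which is zero. Against an older observation the prediction
        error and \<open>w(t)\<close> vanish separately.\<close>
      proof (cases "s = t")
        case True
        have "ip M (es i) f = (\<Sum>l<n. G $$ (i, l) * (P * Cm\<^sup>T) $$ (l, k)) - (\<Sum>l<N. K $$ (i, l) * R $$ (l, k))"
          using f True by (simp add: ip_es ip_e_Y ip_W_Y)
        also have "\<dots> = (G * (P * Cm\<^sup>T)) $$ (i, k) - (K * R) $$ (i, k)"
          using index_mult_mat_sum[OF G mult_carrier_mat[OF P CmT] i f(3)]
            index_mult_mat_sum[OF K R i f(3)] by simp
        also have "G * (P * Cm\<^sup>T) = K * R"
          using assoc_mult_mat[OF G P CmT] GP KR by simp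
        finally show ?thesis by simp
      next
        case False
        then have s: "s \<le> t - 1" using f by simp
        have "Y s k \<in> closed_linear_span M (observations y N (t - 1))"
          using s f(3) observations_L2[of _ N "t - 1"]
          by (intro linear_combinations_closed_linear_span linear_combinations_superset)
            (auto simp: observations_iff)
        then have "ip M (e l) f = 0" if "l < n" for l using e_orth[OF that] f(1) by simp
        moreover have "ip M (W t l) f = 0" for l
          using False f(1) ip_Y_W[of t s k l] by (simp add: ip_commute[of M "W t l"])
        ultimately show ?thesis using f(1) by (simp add: ip_es)
      qed
    qed
    moreover have "ip M (es' i) g = ip M (es i) g"
      using i closed_linear_span_square_integrable[OF g] by (intro ip_cong_AE es_AE) auto
    ultimately show ?thesis by simp
  qed
  have es'_X: "ip M (es' i) (X t j) = Pf $$ (i, j)" if i: "i < n" and j: "j < n" for i j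
  proof -
    have "ip M (es' i) (X t j) = ip M (es i) (X t j)"
      using i j by (intro ip_cong_AE es_AE) auto
    also have "\<dots> = (\<Sum>l<n. G $$ (i, l) * P $$ (l, j))"
      using j by (simp add: ip_es ip_e_X ip_commute[of M "W t _"] ip_X_W)
    also have "\<dots> = Pf $$ (i, j)" using index_mult_mat_sum[OF G P i j] GP by simp
    finally show ?thesis .
  qed
  \<comment> \<open>Both errors are orthogonal to a span that contains both estimates. Within a
    pairing, each estimate can therefore be dropped or inserted, which turns the filter error into
    \<open>es'\<close> one factor at a time.\<close>
  have "ip M (ef i) (ef j) = Pf $$ (i, j)" if i: "i < n" and j: "j < n" for i j
  proof -
    have "ip M (ef i) (ef j) = ip M (ef j) (\<lambda>\<omega>. X t i \<omega> - xf \<omega> $ i)"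
      by (simp add: ef_def ip_commute)
    also have "\<dots> = ip M (ef j) (X t i)"
      using i j ef_orth[OF j span_f[OF i]] by (simp add: ip_diff_right)
    also have "\<dots> = ip M (ef j) (es' i)"
      using i j ef_orth[OF j span_xs[OF i]] by (simp add: es'_def ip_diff_right)
    also have "\<dots> = ip M (es' i) (\<lambda>\<omega>. X t j \<omega> - xf \<omega> $ j)"
      by (simp add: ef_def ip_commute)
    also have "\<dots> = Pf $$ (i, j)"
      using i j es'_orth[OF i span_f[OF j]] by (simp add: ip_diff_right es'_X)
    finally show ?thesis .
  qed
  then have "cov_mat M n (\<lambda>\<omega>. x t \<omega> - xf \<omega>) = Pf"
    using Pf(1) unfolding error_cov_eq[OF xf] ef_def by (intro eq_matI) auto
  then show ?thesis by (simp add: Pf_def S_def R_def)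
qed

section \<open>Convergence of the filtering error\<close>

abbreviation gram :: "nat \<Rightarrow> real mat" where
  "gram N \<equiv> (first_rows N n C)\<^sup>T * first_rows N n C"

text \<open>The condition on \<open>a\<close> cancels every state component except the
  \<open>i\<close>-th, so the weighted observations err only by noise; minimality of the filter over
  a span that contains them gives the inequality.\<close>

lemma filter_error_le:
  assumes filt: "kalman_estimate M n x y N t t xf" and i: "i < n"
    and a: "\<And>j. j < n \<Longrightarrow> (\<Sum>k<N. a k * C k j) = (if j = i then 1 else 0)"
  shows "ip M (\<lambda>\<omega>. X t i \<omega> - xf \<omega> $ i) (\<lambda>\<omega>. X t i \<omega> - xf \<omega> $ i)
    \<le> ip M (\<lambda>\<omega>. \<Sum>k<N. a k * W t k \<omega>) (\<lambda>\<omega>. \<Sum>k<N. a k * W t k \<omega>)"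
proof -
  let ?g = "\<lambda>\<omega>. \<Sum>k<N. a k * Y t k \<omega>" and ?w = "\<lambda>\<omega>. \<Sum>k<N. a k * W t k \<omega>"
  have best: "best_linear_estimate M (observations y N t) (X t i) (\<lambda>\<omega>. xf \<omega> $ i)"
    using filt i by (simp add: kalman_estimate_def X_def)
  have "?g \<in> closed_linear_span M (observations y N t)"
    by (intro linear_combinations_closed_linear_span observations_L2 linear_combinations_sum
        linear_combinations_cmult linear_combinations_superset)
      (auto simp: observations_iff)
  then have "ip M (\<lambda>\<omega>. X t i \<omega> - xf \<omega> $ i) (\<lambda>\<omega>. X t i \<omega> - xf \<omega> $ i)
      \<le> ip M (\<lambda>\<omega>. X t i \<omega> - ?g \<omega>) (\<lambda>\<omega>. X t i \<omega> - ?g \<omega>)"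
    using bspec[OF conjunct2[OF best[unfolded best_linear_estimate_def]], of ?g]
    by (simp add: ip_def power2_eq_square)
  also have "\<dots> = ip M (\<lambda>\<omega>. (- 1) * ?w \<omega>) (\<lambda>\<omega>. (- 1) * ?w \<omega>)"
  proof -
    have "AE \<omega> in M. \<forall>k<N. Y t k \<omega> = (\<Sum>j<n. C k j * X t j \<omega>) + W t k \<omega>"
      by (intro AE_all_less output_AE)
    then have AE: "AE \<omega> in M. X t i \<omega> - ?g \<omega> = (- 1) * ?w \<omega>"
    proof eventually_elim
      case (elim \<omega>)
      have "?g \<omega> = (\<Sum>k<N. \<Sum>j<n. a k * (C k j * X t j \<omega>)) + ?w \<omega>"
        using elim by (simp add: distrib_left sum.distrib sum_distrib_left)
      also have "(\<Sum>k<N. \<Sum>j<n. a k * (C k j * X t j \<omega>)) = (\<Sum>j<n. \<Sum>k<N. a k * (C k j * X t j \<omega>))"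
        by (rule sum.swap)
      also have "\<dots> = (\<Sum>j<n. (if j = i then 1 else 0) * X t j \<omega>)"
      proof (rule sum.cong)
        fix j assume "j \<in> {..<n}"
        then have "(\<Sum>k<N. a k * C k j) = (if j = i then 1 else 0)" by (intro a) simp
        then show "(\<Sum>k<N. a k * (C k j * X t j \<omega>)) = (if j = i then 1 else 0) * X t j \<omega>"
          by (simp only: sum_distrib_right[symmetric] mult.assoc[symmetric])
      qed simp
      also have "\<dots> = X t i \<omega>" using i by (simp add: if_distrib[of "\<lambda>c. c * _"] cong: if_cong)
      finally show ?case by simp
    qed
    have "square_integrable M (\<lambda>\<omega>. X t i \<omega> - ?g \<omega>)" using i by simp
    moreover have "square_integrable M (\<lambda>\<omega>. (- 1) * ?w \<omega>)" by (rule square_integrable_cmult) simp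
    ultimately show ?thesis by (intro ip_cong_AE AE)
  qed
  also have "\<dots> = ip M ?w ?w" by (simp add: ip_def)
  finally show ?thesis .
qed

text \<open>Among the exact weights these have least length. With \<open>S = C_N^T C_N\<close>,
  \<open>b = S^-1 e_i\<close> and \<open>a = C_N b\<close>, the squared length of \<open>a\<close>
  is \<open>b_i\<close>. If \<open>l\<close> is the least eigenvalue, then
  \<open>l b_i^2 <= l (b . b) <= b . S b = b_i\<close>, whence \<open>b_i <= 1 / l\<close>.\<close>

lemma exact_weights:
  assumes pos: "0 < lambda_min (gram N)" and i: "i < n"
  obtains a :: "nat \<Rightarrow> real"
  where "\<And>j. j < n \<Longrightarrow> (\<Sum>k<N. a k * C k j) = (if j = i then 1 else 0)"
    "(\<Sum>k<N. (a k)\<^sup>2) \<le> 1 / lambda_min (gram N)"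
proof -
  define Cm where "Cm = first_rows N n C"
  define S where "S = gram N"
  define l where "l = lambda_min S"
  have l: "l > 0" using pos by (simp add: l_def S_def)
  have Cm: "Cm \<in> carrier_mat N n" by (simp add: Cm_def first_rows_def)
  have S: "S \<in> carrier_mat n n" unfolding S_def using Cm by (simp add: Cm_def)
  have sym: "S\<^sup>T = S" unfolding S_def Cm_def[symmetric]
    using transpose_mult[of "Cm\<^sup>T" n N Cm n] Cm by simp
  have low: "l * (u \<bullet> u) \<le> u \<bullet> (S *\<^sub>v u)" if "u \<in> carrier_vec n" for u
    unfolding l_def by (rule lambda_min_le_Rayleigh[OF S sym that])
  have "positive_definite n S" unfolding positive_definite_def
  proof (intro conjI ballI impI S sym)
    fix u :: "real vec" assume u: "u \<in> carrier_vec n" "u \<noteq> 0\<^sub>v n"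
    have "0 < l * (u \<bullet> u)" using l scalar_prod_self_pos[OF u] by simp
    then show "0 < u \<bullet> (S *\<^sub>v u)" using low[OF u(1)] by linarith
  qed
  note Si = positive_definite_inverse[OF this]
  define b where "b = inv_mat S *\<^sub>v unit_vec n i"
  have b: "b \<in> carrier_vec n" unfolding b_def using Si by simp
  have Sb: "S *\<^sub>v b = unit_vec n i"
    unfolding b_def using assoc_mult_mat_vec[OF S Si(1), of "unit_vec n i"] Si(2) by simp
  define a where "a = Cm *\<^sub>v b"
  have a: "a \<in> carrier_vec N" unfolding a_def using Cm b by simp
  have Ca: "Cm\<^sup>T *\<^sub>v a = unit_vec n i"
    unfolding a_def Sb[symmetric] S_def Cm_def[symmetric]
    using assoc_mult_mat_vec[of "Cm\<^sup>T" n N Cm n b] Cm b by simp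
  have "(\<Sum>k<N. a $ k * C k j) = (if j = i then 1 else 0)" if j: "j < n" for j
  proof -
    have "(Cm\<^sup>T *\<^sub>v a) $ j = (\<Sum>k<N. C k j * a $ k)"
      using j a Cm by (simp add: scalar_prod_def atLeast0LessThan Cm_def first_rows_def)
    then show ?thesis unfolding Ca using i j by (simp add: mult.commute unit_vec_def)
  qed
  moreover have "(\<Sum>k<N. (a $ k)\<^sup>2) \<le> 1 / l"
  proof -
    have "(\<Sum>k<N. (a $ k)\<^sup>2) = a \<bullet> a"
      using a by (simp add: scalar_prod_def atLeast0LessThan power2_eq_square)
    also have "\<dots> = (Cm\<^sup>T *\<^sub>v a) \<bullet> b"
      using transpose_vec_mult_scalar[OF Cm b a] by (simp add: a_def)
    also have "\<dots> = b $ i" unfolding Ca using b i by simp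
    finally have aa: "(\<Sum>k<N. (a $ k)\<^sup>2) = b $ i" .
    have "l * (b \<bullet> b) \<le> b $ i" using low[OF b] b i by (simp add: Sb)
    moreover have "(b $ i)\<^sup>2 \<le> b \<bullet> b"
      using b i by (simp add: scalar_prod_def power2_eq_square member_le_sum[of i "{0..<n}" "\<lambda>k. b $ k * b $ k"])
    ultimately have "l * (b $ i)\<^sup>2 \<le> b $ i" using l by (meson mult_left_mono less_imp_le order_trans)
    moreover have "0 \<le> b $ i" unfolding aa[symmetric] by (simp add: sum_nonneg)
    ultimately have "l * b $ i \<le> 1"
      using l by (cases "b $ i = 0") (auto simp: power2_eq_square)
    then show ?thesis unfolding aa using l by (simp add: field_simps)
  qed
  ultimately show thesis using that[of "\<lambda>k. a $ k"] by (simp add: l_def S_def)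
qed

lemma ip_W_stationary: "ip M (W t k) (W t l) = ip M (W 0 k) (W 0 l)"
  using w_stationary[unfolded wide_sense_stationary_def, rule_format, of k l 0 t 0]
  by (simp add: ip_def W_def)

text \<open>The idiosyncratic property concerns infinite weight sequences at time 0. Padding with
  zeros makes every series in it eventually constant, and stationarity of \<open>w\<close> carries
  the result to time \<open>t\<close>.\<close>

lemma idiosyncratic_finite_weights:
  assumes a: "(\<lambda>N. \<Sum>k<N. (a N k)\<^sup>2) \<longlonglongrightarrow> 0"
  shows "(\<lambda>N. ip M (\<lambda>\<omega>. \<Sum>k<N. a N k * W t k \<omega>) (\<lambda>\<omega>. \<Sum>k<N. a N k * W t k \<omega>)) \<longlonglongrightarrow> 0"
proof -
  define b where "b N k = (if k < N then a N k else 0)" for N k :: nat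
  have trunc: "(\<Sum>k<K. b N k * f k) = (\<Sum>k<N. a N k * f k)" if "N \<le> K" for N K and f :: "nat \<Rightarrow> real"
    using that by (intro sum.mono_neutral_cong_right) (auto simp: b_def)
  have sq: "(\<lambda>k. (b N k)\<^sup>2) sums (\<Sum>k<N. (a N k)\<^sup>2)" for N
    using sums_finite[of "{..<N}" "\<lambda>k. (b N k)\<^sup>2"] by (simp add: b_def)
  have bw: "(\<Sum>k<K. b N k * w 0 \<omega> k) = (\<Sum>k<N. a N k * w 0 \<omega> k)" if "N \<le> K" for N K \<omega>
    by (rule trunc[OF that])
  have wL: "square_integrable M (\<lambda>\<omega>. \<Sum>k<K. c k * w 0 \<omega> k)" for K c
    using L2(4)[of 0] by (intro square_integrable_sum square_integrable_cmult) (simp add: W_def)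
  have "mean_square_limit M (\<lambda>N \<omega>. \<Sum>k<N. a N k * w 0 \<omega> k) (\<lambda>\<omega>. 0)"
  proof (rule w_idiosyncratic[unfolded idiosyncratic_def, rule_format, of b], intro conjI allI)
    fix N
    show "summable (\<lambda>k. (b N k)\<^sup>2)" using sq by (rule sums_summable)
    show "finite_quadratic_form (\<lambda>i j. \<integral>\<omega>. w 0 \<omega> i * w 0 \<omega> j \<partial>M) (b N)"
      unfolding finite_quadratic_form_def
    \<comment> \<open>Once both truncation indices are at least \<open>N\<close>, the double partial
      sums no longer change, so the limit is the finite sum.\<close>
    proof (intro exI tendsto_eventually)
      let ?s = "\<lambda>i j. \<integral>\<omega>. w 0 \<omega> i * w 0 \<omega> j \<partial>M"
      have "(\<Sum>i<K. \<Sum>j<L. b N i * ?s i j * b N j) = (\<Sum>i<N. a N i * (\<Sum>j<N. a N j * ?s i j))"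
        if "N \<le> K" "N \<le> L" for K L
      proof -
        have "(\<Sum>i<K. \<Sum>j<L. b N i * ?s i j * b N j) = (\<Sum>i<K. b N i * (\<Sum>j<L. b N j * ?s i j))"
          by (simp add: sum_distrib_left mult_ac)
        also have "\<dots> = (\<Sum>i<K. b N i * (\<Sum>j<N. a N j * ?s i j))"
          by (simp only: trunc[OF that(2)])
        also have "\<dots> = (\<Sum>i<N. a N i * (\<Sum>j<N. a N j * ?s i j))" by (rule trunc[OF that(1)])
        finally show ?thesis .
      qed
      then show "\<forall>\<^sub>F p in sequentially \<times>\<^sub>F sequentially.
          (case p of (K, L) \<Rightarrow> \<Sum>i<K. \<Sum>j<L. b N i * ?s i j * b N j) = (\<Sum>i<N. a N i * (\<Sum>j<N. a N j * ?s i j))"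
        unfolding eventually_prod_filter
        by (intro exI[of _ "\<lambda>K. N \<le> K"] conjI eventually_ge_at_top) auto
    qed
    show "mean_square_limit M (\<lambda>K \<omega>. \<Sum>k<K. b N k * w 0 \<omega> k) (\<lambda>\<omega>. \<Sum>k<N. a N k * w 0 \<omega> k)"
      unfolding mean_square_limit_def
    proof (intro conjI allI wL tendsto_eventually)
      show "\<forall>\<^sub>F K in sequentially. (\<integral>\<omega>. ((\<Sum>k<K. b N k * w 0 \<omega> k) - (\<Sum>k<N. a N k * w 0 \<omega> k))\<^sup>2 \<partial>M) = 0"
        using eventually_ge_at_top[of N] by eventually_elim (simp add: bw)
    qed
  next
    show "(\<lambda>N. sqrt (\<Sum>k. (b N k)\<^sup>2)) \<longlonglongrightarrow> 0"
      unfolding sums_unique[OF sq, symmetric] using tendsto_real_sqrt[OF a] by simp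
  qed
  moreover have "ip M (\<lambda>\<omega>. \<Sum>k<N. a N k * W t k \<omega>) (\<lambda>\<omega>. \<Sum>k<N. a N k * W t k \<omega>) =
      ip M (\<lambda>\<omega>. \<Sum>k<N. a N k * W 0 k \<omega>) (\<lambda>\<omega>. \<Sum>k<N. a N k * W 0 k \<omega>)" for N
    by (simp add: ip_sum_cmult_left ip_sum_cmult_right ip_W_stationary[of t])
  ultimately show ?thesis by (simp add: mean_square_limit_ip W_def)
qed

lemma filter_variance_tendsto_0:
  assumes filt: "\<And>N. N \<ge> 1 \<Longrightarrow> kalman_estimate M n x y N t t (xf N)" and i: "i < n"
  shows "(\<lambda>N. ip M (\<lambda>\<omega>. X t i \<omega> - xf N \<omega> $ i) (\<lambda>\<omega>. X t i \<omega> - xf N \<omega> $ i)) \<longlonglongrightarrow> 0"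
proof -
  have pos: "\<forall>\<^sub>F N in sequentially. 0 < lambda_min (gram N)"
    using strongly_independent by (simp add: filterlim_at_top_dense)
  \<comment> \<open>Weights exist only once \<open>C_N\<close> has full column rank, which holds for
    all large \<open>N\<close>. The guard inside the existential lets one choice function serve
    every \<open>N\<close>.\<close>
  have "\<exists>a. 0 < lambda_min (gram N) \<longrightarrow>
      (\<forall>j<n. (\<Sum>k<N. a k * C k j) = (if j = i then 1 else 0)) \<and> (\<Sum>k<N. (a k)\<^sup>2) \<le> 1 / lambda_min (gram N)" for N
    using exact_weights[OF _ i, of N] by metis
  then obtain a where a: "\<And>N. 0 < lambda_min (gram N) \<Longrightarrow>
      (\<forall>j<n. (\<Sum>k<N. a N k * C k j) = (if j = i then 1 else 0)) \<and> (\<Sum>k<N. (a N k)\<^sup>2) \<le> 1 / lambda_min (gram N)"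
    by metis
  have "(\<lambda>N. \<Sum>k<N. (a N k)\<^sup>2) \<longlonglongrightarrow> 0"
  proof (rule tendsto_sandwich[OF _ _ tendsto_const])
    show "\<forall>\<^sub>F N in sequentially. (\<Sum>k<N. (a N k)\<^sup>2) \<le> 1 / lambda_min (gram N)"
      using pos by eventually_elim (use a in blast)
    show "(\<lambda>N. 1 / lambda_min (gram N)) \<longlonglongrightarrow> 0"
      using tendsto_inverse_0_at_top[OF strongly_independent] by (simp add: inverse_eq_divide)
  qed (simp add: sum_nonneg)
  then have lim: "(\<lambda>N. ip M (\<lambda>\<omega>. \<Sum>k<N. a N k * W t k \<omega>) (\<lambda>\<omega>. \<Sum>k<N. a N k * W t k \<omega>)) \<longlonglongrightarrow> 0"
    by (rule idiosyncratic_finite_weights)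
  show ?thesis
  proof (rule tendsto_sandwich[OF _ _ tendsto_const lim])
    show "\<forall>\<^sub>F N in sequentially. ip M (\<lambda>\<omega>. X t i \<omega> - xf N \<omega> $ i) (\<lambda>\<omega>. X t i \<omega> - xf N \<omega> $ i)
        \<le> ip M (\<lambda>\<omega>. \<Sum>k<N. a N k * W t k \<omega>) (\<lambda>\<omega>. \<Sum>k<N. a N k * W t k \<omega>)"
      using pos eventually_ge_at_top[of 1]
    proof eventually_elim
      case (elim N)
      show ?case by (rule filter_error_le[OF filt[OF elim(2)] i]) (use a[OF elim(1)] in blast)
    qed
  qed simp
qed

text \<open>By Cauchy-Schwarz each entry is dominated by the two diagonal entries, which are the
  error variances already known to vanish.\<close>

lemma filter_cov_tendsto_0:
  assumes filt: "\<And>N. N \<ge> 1 \<Longrightarrow> kalman_estimate M n x y N t t (xf N)" and i: "i < n" and j: "j < n"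
  shows "(\<lambda>N. cov_mat M n (\<lambda>\<omega>. x t \<omega> - xf N \<omega>) $$ (i, j)) \<longlonglongrightarrow> 0"
proof -
  let ?e = "\<lambda>N i \<omega>. X t i \<omega> - xf N \<omega> $ i"
  have eL: "square_integrable M (?e N k)" if "N \<ge> 1" "k < n" for N k
  proof -
    have "(\<lambda>\<omega>. xf N \<omega> $ k) \<in> closed_linear_span M (observations y N t)"
      using filt[OF that(1)] that(2) by (simp add: kalman_estimate_def best_linear_estimate_def)
    from closed_linear_span_square_integrable[OF this] that show ?thesis by simp
  qed
  have bound: "norm (cov_mat M n (\<lambda>\<omega>. x t \<omega> - xf N \<omega>) $$ (i, j))
      \<le> sqrt (ip M (?e N i) (?e N i) * ip M (?e N j) (?e N j))" if N: "N \<ge> 1" for N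
  proof -
    have "xf N \<omega> \<in> carrier_vec n" for \<omega> using filt[OF N] by (simp add: kalman_estimate_def)
    then have "cov_mat M n (\<lambda>\<omega>. x t \<omega> - xf N \<omega>) $$ (i, j) = ip M (?e N i) (?e N j)"
      using i j by (simp add: error_cov_eq)
    then show ?thesis
      using ip_Cauchy_Schwarz[OF eL[OF N i] eL[OF N j]] by (simp add: real_le_rsqrt)
  qed
  have "(\<lambda>N. sqrt (ip M (?e N i) (?e N i) * ip M (?e N j) (?e N j))) \<longlonglongrightarrow> 0"
    using tendsto_real_sqrt[OF tendsto_mult[OF filter_variance_tendsto_0[OF filt i] filter_variance_tendsto_0[OF filt j]]]
    by simp
  then show ?thesis
    by (rule Lim_null_comparison[OF eventually_sequentiallyI[of 1], rotated]) (rule bound)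
qed

end

theorem corollary2:
  fixes M :: "'a measure"
    and n :: nat
    and A Q :: "real mat"
    and C :: "nat \<Rightarrow> nat \<Rightarrow> real"
    and x v :: "int \<Rightarrow> 'a \<Rightarrow> real vec"
    and y w :: "int \<Rightarrow> 'a \<Rightarrow> nat \<Rightarrow> real"
    and x_filt x_pred :: "nat \<Rightarrow> int \<Rightarrow> 'a \<Rightarrow> real vec"
    and Ctr :: "nat \<Rightarrow> real mat"
    and R P Pi\<^sub>f :: "nat \<Rightarrow> int \<Rightarrow> real mat"
  assumes model: "dgfa_model M n A Q C x v y w"
    and filter: "\<And>N t. N \<ge> 1 \<Longrightarrow> kalman_estimate M n x y N t t (x_filt N t)"
    and predictor: "\<And>N t. N \<ge> 1 \<Longrightarrow> kalman_estimate M n x y N t (t - 1) (x_pred N t)"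
  defines "Ctr \<equiv> \<lambda>N. first_rows N n C"
    and "R \<equiv> \<lambda>N t. cov_mat M N (\<lambda>\<omega>. vec N (w t \<omega>))"
    and "P \<equiv> \<lambda>N t. cov_mat M n (\<lambda>\<omega>. x t \<omega> - x_pred N t \<omega>)"
    and "Pi\<^sub>f \<equiv> \<lambda>N t. cov_mat M n (\<lambda>\<omega>. x t \<omega> - x_filt N t \<omega>)"
  shows "\<forall>t. (\<forall>N\<ge>1. positive_definite n (P N t) \<and>
            Pi\<^sub>f N t = inv_mat (inv_mat (P N t) + (Ctr N)\<^sup>T * inv_mat (R N t) * Ctr N)) \<and>
          (\<forall>i<n. \<forall>j<n. (\<lambda>N. Pi\<^sub>f N t $$ (i, j)) \<longlonglongrightarrow> 0)"
proof -
  interpret dgfa_model M n A Q C x v y w by (rule model)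
  show ?thesis
    unfolding Ctr_def R_def P_def Pi\<^sub>f_def
    using pred_cov_positive_definite[OF _ predictor] filter_cov_eq[OF _ predictor filter]
      filter_cov_tendsto_0[OF filter]
    by blast
qed

end
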